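(* For every complex number $x\neq -1$ for which the outer infinite series (over $n$) below converges, one has $$\sum_{n=0}^\infty\binom{2n}n\left(\frac x{(1+x)^2}\right)^n\sum_{k=0}^n\binom nk\binom{n+k}n\binom{2k}k x^k\,\bigl(2x(3+4x)-n(1-x)(3+5x)+4k(1+x)(1+4x)\bigr)=0.$$ Here the last factor, which depends on $n$ and $k$, lies inside the inner sum over $k$. *)

theory Defs
  imports "HOL-Analysis.Analysis"
begin

definition inner_sum :: "complex \<Rightarrow> nat \<Rightarrow> complex" where
  "inner_sum x n =
     (\<Sum>k=0..n. of_nat (n choose k) * of_nat ((n + k) choose n) * of_nat ((2 * k) choose k) * x ^ k *
        (2 * x * (3 + 4 * x) - of_nat n * (1 - x) * (3 + 5 * x)
          + 4 * of_nat k * (1 + x) * (1 + 4 * x)))"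

definition series_term :: "complex \<Rightarrow> nat \<Rightarrow> complex" where
  "series_term x n = of_nat ((2 * n) choose n) * (x / (1 + x)\<^sup>2) ^ n * inner_sum x n"

end

theory Submission
  imports Defs "HOL-Real_Asymp.Real_Asymp"
begin

text \<open>
  By Clausen's formula the inner sum is a product \<open>L n * M n\<close>, where \<open>L n\<close> is a Legendre polynomial at \<open>sqrt (1 + 4 x)\<close> and
  \<open>M n\<close> is a combination of \<open>L n\<close> and \<open>L (n - 1)\<close>. Put \<open>x = w\<^sup>2 / (4 (1 - w\<^sup>2))\<close> with \<open>Re w \<ge> 0\<close>. The growth rate of \<open>L n\<close>
  shows that convergence forces \<open>norm (4 w (1 + w)) \<le> norm (4 - 3 w\<^sup>2)\<close>. The partial sums do not telescope in \<open>n\<close>, but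
  after division by \<open>(1 + x)\<^sup>2\<close> their derivatives in \<open>w\<close> do. On the segment from \<open>0\<close> to \<open>w\<close> the ratio
  \<open>norm (4 w (1 + w)) / norm (4 - 3 w\<^sup>2)\<close> stays below \<open>1\<close> except possibly at the endpoint, where it arrives with positive slope.
  Integrating the telescoped derivative, of size \<open>sqrt n\<close> times the \<open>2n\<close>-th power of this ratio, along the segment
  bounds the \<open>n\<close>-th partial sum by a multiple of \<open>1 / sqrt n\<close>, also on the boundary of the region of convergence.
\<close>

subsection \<open>Clausen's formula\<close>

text \<open>Since \<open>1 + 4 * x = 1 / (1 - w^2)\<close>, the Legendre recurrence can be
  normalized so that its characteristic polynomial is \<open>m^2 - 2 * m + (1 - w^2)\<close>, with
  roots \<open>1 + w\<close> and \<open>1 - w\<close>. For \<open>Re w \<ge> 0\<close> the root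
  \<open>1 + w\<close> dominates, and the terms of the series are controlled by powers of
  \<open>(4 * w * (1 + w) / (4 - 3 * w^2))^2\<close>; this is the origin of the ratio. The obstacle
  is the curve where the ratio has modulus 1: the central binomial contributes n^(-1/2), the two
  Legendre factors 1/n and the linear coefficient n, so the terms are only O(n^(-1/2)) there and
  absolute convergence is out of reach. Summability therefore serves only to place w in the closed
  region, through boundedness of the terms, and convergence to 0 is proved afresh. The segment
  starts at 0, where all partial sums vanish. The derivative of the n-th partial sum has size sqrt n
  near the endpoint but is concentrated within distance of order 1/n of it, because the squared
  ratio at \<open>s * w\<close> is at most \<open>exp (- \<kappa> * (1 - s^2))\<close>; its integral
  is then of order sqrt n / n.\<close>

definition legendre_coeff :: "nat \<Rightarrow> nat \<Rightarrow> complex" where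
  "legendre_coeff n k = of_nat (n choose k) * of_nat ((n + k) choose n) * of_nat ((2 * k) choose k)"

text \<open>The square of the n-th Legendre polynomial at a square root of \<open>1 + 4 * x\<close>;
  see \<open>legendre_clausen\<close> with \<open>b = 1\<close>.\<close>

definition legendre_sq :: "complex \<Rightarrow> nat \<Rightarrow> complex" where
  "legendre_sq x n = (\<Sum>k\<le>n. legendre_coeff n k * x ^ k)"

text \<open>The weight n - k, rather than k, makes this sum a product of two consecutive Legendre
  polynomials up to explicit factors.\<close>

definition legendre_mix :: "complex \<Rightarrow> nat \<Rightarrow> complex" where
  "legendre_mix x n = (\<Sum>k\<le>n. (of_nat n - of_nat k) * legendre_coeff n k * x ^ k)"

lemma inner_sum_eq:
  "inner_sum x n = (2 * x * (3 + 4 * x) + of_nat n * (1 + 18 * x + 21 * x\<^sup>2)) * legendre_sq x n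
     - 4 * (1 + x) * (1 + 4 * x) * legendre_mix x n"
proof -
  have "(2 * x * (3 + 4 * x) + of_nat n * (1 + 18 * x + 21 * x\<^sup>2)) * legendre_sq x n
     - 4 * (1 + x) * (1 + 4 * x) * legendre_mix x n
    = (\<Sum>k\<le>n. (2 * x * (3 + 4 * x) + of_nat n * (1 + 18 * x + 21 * x\<^sup>2)) * (legendre_coeff n k * x ^ k)
       - 4 * (1 + x) * (1 + 4 * x) * ((of_nat n - of_nat k) * legendre_coeff n k * x ^ k))"
    unfolding legendre_sq_def legendre_mix_def sum_distrib_left sum_subtractf ..
  also have "\<dots> = inner_sum x n"
    unfolding inner_sum_def atLeast0AtMost legendre_coeff_def
    by (intro sum.cong refl) (simp add: algebra_simps power2_eq_square)
  finally show ?thesis ..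
qed

section \<open>Ratios of neighbouring coefficients\<close>

lemma Suc_times_central_binomial:
  "Suc k * (2 * Suc k choose Suc k) = 2 * (2 * k + 1) * (2 * k choose k)"
proof -
  have "Suc k * (2 * Suc k choose Suc k) = (2 * k + 2) * (2 * k + 1 choose k)"
    using binomial_absorption[of k "2 * Suc k"] by simp
  moreover have "Suc k * (2 * k + 1 choose k) = (2 * k + 1) * (2 * k choose k)"
    using binomial_absorb_comp[of "2 * k + 1" k] by simp
  ultimately show ?thesis by simp
qed

lemma legendre_coeff_eq_0: "n < k \<Longrightarrow> legendre_coeff n k = 0"
  by (simp add: legendre_coeff_def)

lemma legendre_coeff_0_right [simp]: "legendre_coeff n 0 = 1"
  by (simp add: legendre_coeff_def)

lemma legendre_coeff_Suc_left:
  "(of_nat n + 1 - of_nat k) * legendre_coeff (Suc n) k = (of_nat n + 1 + of_nat k) * legendre_coeff n k"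
proof (cases "k \<le> n")
  case True
  have 1: "(of_nat n + 1 - of_nat k) * (of_nat (Suc n choose k) :: complex)
             = (of_nat n + 1) * of_nat (n choose k)"
  proof -
    have "(Suc n - k) * (Suc n choose k) = Suc n * (n choose k)"
      using binomial_absorb_comp[of "Suc n" k] by simp
    then have "of_nat (Suc n - k) * (of_nat (Suc n choose k) :: complex) = of_nat (Suc n) * of_nat (n choose k)"
      by (metis of_nat_mult)
    then show ?thesis using True by (simp add: of_nat_diff add.commute)
  qed
  have 2: "(of_nat n + 1) * (of_nat (Suc n + k choose Suc n) :: complex)
             = (of_nat n + 1 + of_nat k) * of_nat (n + k choose n)"
  proof -
    have "Suc n * (Suc (n + k) choose Suc n) = Suc (n + k) * (n + k choose n)"
      by (rule Suc_times_binomial)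
    then have "of_nat (Suc n) * (of_nat (Suc (n + k) choose Suc n) :: complex)
       = of_nat (Suc (n + k)) * of_nat (n + k choose n)"
      by (metis of_nat_mult)
    then show ?thesis by (simp add: algebra_simps)
  qed
  have "(of_nat n + 1) * ((of_nat n + 1 - of_nat k) * legendre_coeff (Suc n) k)
      = (of_nat n + 1) * ((of_nat n + 1 + of_nat k) * legendre_coeff n k)"
    using 1 2 unfolding legendre_coeff_def by (smt (verit) mult.assoc mult.commute)
  moreover have "(of_nat n + 1 :: complex) \<noteq> 0"
    by (metis of_nat_Suc of_nat_neq_0 add.commute)
  ultimately show ?thesis by simp
next
  case False
  then show ?thesis
    by (cases "k = Suc n") (auto simp: legendre_coeff_eq_0)
qed

lemma legendre_coeff_Suc_right:
  "(of_nat k + 1) ^ 3 * legendre_coeff n (Suc k)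
     = 2 * (2 * of_nat k + 1) * (of_nat n + of_nat k + 1) * (of_nat n - of_nat k) * legendre_coeff n k"
proof (cases "k < n")
  case True
  have 1: "(of_nat k + 1) * (of_nat (n choose Suc k) :: complex) = (of_nat n - of_nat k) * of_nat (n choose k)"
  proof -
    have "Suc k * (n choose Suc k) = (n - k) * (n choose k)"
      using binomial_absorption[of k n] binomial_absorb_comp[of n k] by simp
    then have "of_nat (Suc k) * (of_nat (n choose Suc k) :: complex) = of_nat (n - k) * of_nat (n choose k)"
      by (metis of_nat_mult)
    then show ?thesis using True by (simp add: of_nat_diff add.commute)
  qed
  have 2: "(of_nat k + 1) * (of_nat (n + Suc k choose n) :: complex)
             = (of_nat n + of_nat k + 1) * of_nat (n + k choose n)"
  proof -
    have "Suc k * (Suc (n + k) choose Suc k) = Suc (n + k) * (n + k choose k)"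
      by (rule Suc_times_binomial)
    moreover have "(Suc (n + k) choose Suc k) = (n + Suc k choose n)" "(n + k choose k) = (n + k choose n)"
      by (metis add_Suc_right binomial_symmetric diff_add_inverse2 le_add2)
         (metis binomial_symmetric diff_add_inverse2 le_add2)
    ultimately have "Suc k * (n + Suc k choose n) = Suc (n + k) * (n + k choose n)"
      by simp
    then have "of_nat (Suc k) * (of_nat (n + Suc k choose n) :: complex)
       = of_nat (Suc (n + k)) * of_nat (n + k choose n)"
      by (metis of_nat_mult)
    then show ?thesis by (simp add: algebra_simps)
  qed
  have 3: "(of_nat k + 1) * (of_nat (2 * Suc k choose Suc k) :: complex)
             = 2 * (2 * of_nat k + 1) * of_nat (2 * k choose k)"
  proof -
    have "(of_nat k + 1) * (of_nat (2 * Suc k choose Suc k) :: complex)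
       = of_nat (Suc k * (2 * Suc k choose Suc k))"
      unfolding of_nat_mult by simp
    also have "Suc k * (2 * Suc k choose Suc k) = 2 * (2 * k + 1) * (2 * k choose k)"
      by (rule Suc_times_central_binomial)
    finally show ?thesis by (simp add: algebra_simps)
  qed
  show ?thesis
    using 1 2 3 unfolding legendre_coeff_def power3_eq_cube by (smt (verit) mult.assoc mult.commute)
next
  case False
  then show ?thesis
    by (cases "k = n") (auto simp: legendre_coeff_eq_0)
qed


text \<open>Moving n and k together covers the corner where \<open>legendre_coeff_Suc_left\<close>
  degenerates to 0 = 0.\<close>

lemma legendre_coeff_diag:
  "(of_nat n + 1)\<^sup>2 * legendre_coeff (Suc n) (Suc n) = 4 * (2 * of_nat n + 1)\<^sup>2 * legendre_coeff n n"
proof -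
  have "of_nat (Suc n) * (of_nat (2 * Suc n choose Suc n) :: complex)
       = of_nat (2 * (2 * n + 1)) * of_nat (2 * n choose n)"
    using Suc_times_central_binomial[of n] by (metis of_nat_mult)
  then have "(of_nat n + 1) * (of_nat (2 * Suc n choose Suc n) :: complex)
     = 2 * (2 * of_nat n + 1) * of_nat (2 * n choose n)"
    by (simp add: add.commute)
  then have "((of_nat n + 1) * (of_nat (2 * Suc n choose Suc n) :: complex))\<^sup>2
     = (2 * (2 * of_nat n + 1) * of_nat (2 * n choose n))\<^sup>2"
    by (rule arg_cong)
  then show ?thesis
    unfolding legendre_coeff_def by (simp add: power2_eq_square mult_2[symmetric] algebra_simps)
qed

lemma legendre_sq_extend: "n \<le> m \<Longrightarrow> legendre_sq x n = (\<Sum>k\<le>m. legendre_coeff n k * x ^ k)"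
  unfolding legendre_sq_def by (rule sum.mono_neutral_left) (auto simp: legendre_coeff_eq_0)

lemma legendre_mix_extend:
  "n \<le> m \<Longrightarrow> legendre_mix x n = (\<Sum>k\<le>m. (of_nat n - of_nat k) * legendre_coeff n k * x ^ k)"
  unfolding legendre_mix_def by (rule sum.mono_neutral_left) (auto simp: legendre_coeff_eq_0)

text \<open>Coefficientwise this is \<open>legendre_coeff_Suc_left\<close> with n + 1 + k written as
  (2 n + 1) - (n - k).\<close>

lemma legendre_mix_Suc:
  "legendre_mix x (Suc n) = (2 * of_nat n + 1) * legendre_sq x n - legendre_mix x n"
proof -
  have c: "(of_nat (Suc n) - of_nat k) * legendre_coeff (Suc n) k
      = (2 * of_nat n + 1) * legendre_coeff n k - (of_nat n - of_nat k) * legendre_coeff n k" for k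
    using legendre_coeff_Suc_left[of n k] by (simp add: algebra_simps)
  show ?thesis
    unfolding legendre_mix_def[of x "Suc n"] legendre_sq_extend[of n "Suc n", OF le_SucI[OF order_refl]]
      legendre_mix_extend[of n "Suc n", OF le_SucI[OF order_refl]] sum_distrib_left sum_subtractf[symmetric]
    by (intro sum.cong refl) (subst c, simp only: left_diff_distrib mult.assoc)
qed

text \<open>The coefficient of x^(k+1) in \<open>legendre_sq_Suc_Suc\<close>. For k \<le> n all four
  coefficients are rational multiples of one of them, which leaves a rational identity. At k = n + 1
  a denominator vanishes and the diagonal ratio takes over; beyond that everything is 0.\<close>

lemma legendre_coeff_rec:
  "(of_nat n + 2)\<^sup>2 * legendre_coeff (Suc (Suc n)) (Suc k)
    = (2 * of_nat n + 3) * (2 * of_nat k + 3) * legendre_coeff (Suc n) (Suc k)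
      + 4 * (2 * of_nat n + 3) * (2 * of_nat k + 1) * legendre_coeff (Suc n) k
      + (of_nat n + 1)\<^sup>2 * legendre_coeff n (Suc k)"
proof -
  consider "k = Suc n" | "k \<le> n" | "k > Suc n" by linarith
  then show ?thesis
  proof cases
    case 1
    then show ?thesis
      using legendre_coeff_diag[of "Suc n"]
      by (simp add: legendre_coeff_eq_0 power2_eq_square algebra_simps)
  next
    case 2
    define N K c where "N = (of_nat n :: complex)" and "K = (of_nat k :: complex)"
      and "c = legendre_coeff (Suc n) (Suc k)"
    have nz: "N + 1 - K \<noteq> 0" "N + K + 2 \<noteq> 0" "2 * K + 1 \<noteq> 0"
    proof -
      have "N + 1 - K = of_nat (Suc n - k)" using 2 unfolding N_def K_def by (simp add: of_nat_diff)
      moreover have "N + K + 2 = of_nat (Suc (Suc (n + k)))" "2 * K + 1 = of_nat (Suc (2 * k))"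
        unfolding N_def K_def by simp_all
      ultimately show "N + 1 - K \<noteq> 0" "N + K + 2 \<noteq> 0" "2 * K + 1 \<noteq> 0"
        using 2 by (simp_all del: of_nat_Suc)
    qed
    have a: "legendre_coeff (Suc (Suc n)) (Suc k) = (N + K + 3) * c / (N + 1 - K)"
      using legendre_coeff_Suc_left[of "Suc n" "Suc k"] nz
      unfolding c_def N_def K_def by (simp add: field_simps)
    have b: "legendre_coeff n (Suc k) = (N - K) * c / (N + K + 2)"
      using legendre_coeff_Suc_left[of n "Suc k"] nz
      unfolding c_def N_def K_def by (simp add: field_simps)
    have d: "legendre_coeff (Suc n) k = (K + 1) ^ 3 * c / (2 * (2 * K + 1) * (N + K + 2) * (N + 1 - K))"
    proof -
      have "legendre_coeff (Suc n) k * (2 * (2 * K + 1) * (N + K + 2) * (N + 1 - K)) = (K + 1) ^ 3 * c"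
        using legendre_coeff_Suc_right[of k "Suc n"]
        unfolding c_def N_def K_def by (simp add: algebra_simps)
      moreover have "2 * (2 * K + 1) * (N + K + 2) * (N + 1 - K) \<noteq> 0"
        unfolding mult_eq_0_iff using nz by simp
      ultimately show ?thesis by (rule eq_divide_imp[rotated])
    qed
    have "(N + 2)\<^sup>2 * ((N + K + 3) * c / (N + 1 - K))
       = (2 * N + 3) * (2 * K + 3) * c
        + 4 * (2 * N + 3) * (2 * K + 1) * ((K + 1) ^ 3 * c / (2 * (2 * K + 1) * (N + K + 2) * (N + 1 - K)))
        + (N + 1)\<^sup>2 * ((N - K) * c / (N + K + 2))"
    proof -
      have "4 * K + 2 = 2 * (2 * K + 1)" by simp
      then have "4 * K + 2 \<noteq> 0" using nz(3) by (metis mult_eq_0_iff zero_neq_numeral)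
      then show ?thesis using nz by (simp add: divide_simps) algebra
    qed
    then show ?thesis unfolding a b d c_def[symmetric] unfolding N_def K_def .
  qed (simp add: legendre_coeff_eq_0)
qed

text \<open>Together with \<open>legendre_mix_Suc\<close> this is a closed recurrence for the pair
  of sums. It has the shape of the squared three-term Legendre recurrence, with
  \<open>legendre_mix\<close> in the role of the cross term.\<close>

lemma legendre_sq_Suc_Suc:
  "(of_nat n + 2)\<^sup>2 * legendre_sq x (Suc (Suc n))
    = (2 * of_nat n + 3)\<^sup>2 * (1 + 4 * x) * legendre_sq x (Suc n)
      - 2 * (2 * of_nat n + 3) * (1 + 4 * x) * legendre_mix x (Suc n)
      + (of_nat n + 1)\<^sup>2 * legendre_sq x n"
proof -
  define N where "N = (of_nat n :: complex)"
  define m where "m = Suc n"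
  have "(N + 2)\<^sup>2 * legendre_sq x (Suc (Suc n))
      = (N + 2)\<^sup>2 + (\<Sum>k\<le>m. (N + 2)\<^sup>2 * legendre_coeff (Suc (Suc n)) (Suc k) * x ^ Suc k)"
    unfolding legendre_sq_def m_def sum.atMost_Suc_shift
    by (simp add: sum_distrib_left distrib_left mult_ac)
  also have "(\<Sum>k\<le>m. (N + 2)\<^sup>2 * legendre_coeff (Suc (Suc n)) (Suc k) * x ^ Suc k)
     = (\<Sum>k\<le>m. (2 * N + 3) * (2 * of_nat k + 3) * legendre_coeff m (Suc k) * x ^ Suc k)
      + (\<Sum>k\<le>m. 4 * (2 * N + 3) * (2 * of_nat k + 1) * legendre_coeff m k * x ^ Suc k)
      + (\<Sum>k\<le>m. (N + 1)\<^sup>2 * legendre_coeff n (Suc k) * x ^ Suc k)"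
    unfolding sum.distrib[symmetric] N_def m_def
    by (intro sum.cong refl) (simp only: legendre_coeff_rec distrib_right mult.assoc)
  also have "(\<Sum>k\<le>m. (2 * N + 3) * (2 * of_nat k + 3) * legendre_coeff m (Suc k) * x ^ Suc k)
     = (\<Sum>k\<le>Suc m. (2 * N + 3) * (2 * of_nat k + 1) * legendre_coeff m k * x ^ k) - (2 * N + 3)"
    unfolding sum.atMost_Suc_shift by (simp add: algebra_simps)
  also have "(\<Sum>k\<le>m. (N + 1)\<^sup>2 * legendre_coeff n (Suc k) * x ^ Suc k)
     = (N + 1)\<^sup>2 * legendre_sq x n - (N + 1)\<^sup>2"
  proof -
    have "(N + 1)\<^sup>2 * legendre_sq x n = (N + 1)\<^sup>2 * (\<Sum>k\<le>Suc m. legendre_coeff n k * x ^ k)"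
      by (subst legendre_sq_extend[of n "Suc m"]) (auto simp: m_def)
    then show ?thesis
      unfolding sum.atMost_Suc_shift by (simp add: sum_distrib_left distrib_left mult_ac)
  qed
  also have "(\<Sum>k\<le>m. 4 * (2 * N + 3) * (2 * of_nat k + 1) * legendre_coeff m k * x ^ Suc k)
     = 4 * x * (\<Sum>k\<le>m. (2 * N + 3) * (2 * of_nat k + 1) * legendre_coeff m k * x ^ k)"
    by (simp only: sum_distrib_left power_Suc mult_ac)
  also have "(\<Sum>k\<le>Suc m. (2 * N + 3) * (2 * of_nat k + 1) * legendre_coeff m k * x ^ k)
     = (\<Sum>k\<le>m. (2 * N + 3) * (2 * of_nat k + 1) * legendre_coeff m k * x ^ k)"
    by (simp add: legendre_coeff_eq_0)
  \<comment> \<open>With m = n + 1 the weight 2 k + 1 equals (2 n + 3) - 2 (m - k), which splits the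
    sum into the two kinds.\<close>
  also have "(\<Sum>k\<le>m. (2 * N + 3) * (2 * of_nat k + 1) * legendre_coeff m k * x ^ k)
     = (2 * N + 3)\<^sup>2 * legendre_sq x m - 2 * (2 * N + 3) * legendre_mix x m"
    unfolding legendre_sq_def legendre_mix_def sum_distrib_left sum_subtractf[symmetric]
    by (intro sum.cong refl) (simp add: N_def m_def power2_eq_square algebra_simps)
  finally show ?thesis
    unfolding N_def[symmetric] m_def[symmetric] by (simp add: algebra_simps power2_eq_square)
qed

text \<open>
  Here \<open>hom_legendre a b n\<close> is \<open>b ^ (n / 2)\<close> times the Legendre polynomial at \<open>a / sqrt b\<close>; the homogeneous
  form avoids square roots and division, and covers \<open>x = -1/4\<close>, where \<open>a = 0\<close>.
\<close>
fun hom_legendre :: "complex \<Rightarrow> complex \<Rightarrow> nat \<Rightarrow> complex" where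
  "hom_legendre a b 0 = 1"
| "hom_legendre a b (Suc 0) = a"
| "hom_legendre a b (Suc (Suc n)) =
    ((2 * of_nat n + 3) * a * hom_legendre a b (Suc n) - (of_nat n + 1) * b * hom_legendre a b n) / (of_nat n + 2)"

lemma of_nat_add_nonzero:
  "of_nat n + 1 \<noteq> (0 :: complex)" "of_nat n + 2 \<noteq> (0 :: complex)"
proof -
  have "of_nat n + 1 = (of_nat (Suc n) :: complex)" "of_nat n + 2 = (of_nat (Suc (Suc n)) :: complex)" by simp_all
  then show "of_nat n + 1 \<noteq> (0 :: complex)" "of_nat n + 2 \<noteq> (0 :: complex)" by (metis of_nat_neq_0)+
qed

lemma hom_legendre_rec:
  "(of_nat n + 2) * hom_legendre a b (Suc (Suc n)) =
    (2 * of_nat n + 3) * a * hom_legendre a b (Suc n) - (of_nat n + 1) * b * hom_legendre a b n"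
  using of_nat_add_nonzero(2)[of n] by simp

lemma legendre_sq_Suc_0: "legendre_sq x (Suc 0) = 1 + 4 * x" "legendre_sq x 0 = 1"
  "legendre_mix x (Suc 0) = 1" "legendre_mix x 0 = 0"
  by (simp_all add: legendre_sq_def legendre_mix_def legendre_coeff_def numeral_2_eq_2)

text \<open>Squaring the recurrence of \<open>hom_legendre\<close> expresses the next square by two
  squares and a cross product, exactly as \<open>legendre_sq_Suc_Suc\<close> does. The cross term
  forces the three claims to be proved in one induction.\<close>

lemma legendre_clausen:
  assumes "a\<^sup>2 = (1 + 4 * x) * b"
  shows "b ^ n * legendre_sq x n = (hom_legendre a b n)\<^sup>2
    \<and> b ^ Suc n * legendre_sq x (Suc n) = (hom_legendre a b (Suc n))\<^sup>2
    \<and> b ^ Suc n * (1 + 4 * x) * legendre_mix x (Suc n)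
        = (of_nat n + 1) * a * hom_legendre a b (Suc n) * hom_legendre a b n"
proof (induction n)
  case 0
  then show ?case using assms by (simp add: legendre_sq_Suc_0 power2_eq_square mult_ac)
next
  case (Suc n)
  define N where "N = (of_nat n :: complex)"
  let ?H = "hom_legendre a b" and ?P = "legendre_sq x" and ?Q = "legendre_mix x"
  define B where "B = b ^ n"
  define T where "T = 1 + 4 * x"
  have B: "b ^ Suc n = b * B" "b ^ Suc (Suc n) = b * b * B" by (simp_all add: B_def)
  have nz: "N + 2 \<noteq> 0" unfolding N_def by (rule of_nat_add_nonzero)
  have as: "a * a = T * b" using assms by (simp add: power2_eq_square T_def)
  from Suc have IH: "B * ?P n = ?H n * ?H n" "b * B * ?P (Suc n) = ?H (Suc n) * ?H (Suc n)"
    "b * B * T * ?Q (Suc n) = (N + 1) * a * ?H (Suc n) * ?H n"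
    by (simp_all add: B B_def T_def N_def power2_eq_square)
  have H: "(N + 2) * ?H (Suc (Suc n)) = (2 * N + 3) * a * ?H (Suc n) - (N + 1) * b * ?H n"
    unfolding N_def by (rule hom_legendre_rec)
  have P: "(N + 2)\<^sup>2 * ?P (Suc (Suc n)) = (2 * N + 3)\<^sup>2 * T * ?P (Suc n)
      - 2 * (2 * N + 3) * T * ?Q (Suc n) + (N + 1)\<^sup>2 * ?P n"
    unfolding N_def T_def by (rule legendre_sq_Suc_Suc)
  have Q: "?Q (Suc (Suc n)) = (2 * N + 3) * ?P (Suc n) - ?Q (Suc n)"
    using legendre_mix_Suc[of x "Suc n"] by (simp add: N_def add_ac)
  have "(N + 2)\<^sup>2 * (b * b * B * ?P (Suc (Suc n))) = b * b * B * ((N + 2)\<^sup>2 * ?P (Suc (Suc n)))"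
    by (simp add: mult_ac)
  also have "\<dots> = (2 * N + 3)\<^sup>2 * (T * b) * (b * B * ?P (Suc n))
      - 2 * (2 * N + 3) * b * (b * B * T * ?Q (Suc n)) + (N + 1)\<^sup>2 * b * b * (B * ?P n)"
    unfolding P by (simp add: algebra_simps)
  also have "\<dots> = ((2 * N + 3) * a * ?H (Suc n) - (N + 1) * b * ?H n)\<^sup>2"
    unfolding IH as[symmetric] by (simp add: algebra_simps power2_eq_square)
  also have "\<dots> = (N + 2)\<^sup>2 * (?H (Suc (Suc n)))\<^sup>2"
    unfolding H[symmetric] power_mult_distrib ..
  finally have 1: "b * b * B * ?P (Suc (Suc n)) = (?H (Suc (Suc n)))\<^sup>2"
    using nz by simp
  have "b * b * B * T * ?Q (Suc (Suc n)) = (2 * N + 3) * (T * b) * (b * B * ?P (Suc n)) - b * (b * B * T * ?Q (Suc n))"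
    unfolding Q by (simp add: algebra_simps)
  also have "\<dots> = a * ?H (Suc n) * ((2 * N + 3) * a * ?H (Suc n) - (N + 1) * b * ?H n)"
    unfolding IH as[symmetric] by (simp add: algebra_simps)
  also have "\<dots> = (N + 2) * a * ?H (Suc (Suc n)) * ?H (Suc n)"
    unfolding H[symmetric] by (simp add: mult_ac)
  finally have 2: "b * b * B * T * ?Q (Suc (Suc n)) = (N + 2) * a * ?H (Suc (Suc n)) * ?H (Suc n)" .
  show ?case
    using Suc 1 2 unfolding B by (simp add: T_def N_def add_ac)
qed

text \<open>The factor \<open>1 + 4 * x\<close> in front of \<open>legendre_mix\<close> in
  \<open>inner_sum_eq\<close> is the one that Clausen's formula supplies, so nothing is divided by
  it and x = -1/4 stays included.\<close>

lemma inner_sum_hom_legendre: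
  assumes "a\<^sup>2 = (1 + 4 * x) * b"
  shows "b ^ Suc n * inner_sum x (Suc n) = hom_legendre a b (Suc n) *
    ((2 * x * (3 + 4 * x) + (of_nat n + 1) * (1 + 18 * x + 21 * x\<^sup>2)) * hom_legendre a b (Suc n)
     - 4 * (1 + x) * a * (of_nat n + 1) * hom_legendre a b n)"
proof -
  define A where "A = 2 * x * (3 + 4 * x) + (of_nat n + 1) * (1 + 18 * x + 21 * x\<^sup>2)"
  let ?H = "hom_legendre a b"
  have "b ^ Suc n * inner_sum x (Suc n) = A * (b ^ Suc n * legendre_sq x (Suc n))
    - 4 * (1 + x) * (b ^ Suc n * (1 + 4 * x) * legendre_mix x (Suc n))"
    unfolding inner_sum_eq A_def by (simp add: algebra_simps)
  also have "\<dots> = A * (?H (Suc n))\<^sup>2 - 4 * (1 + x) * ((of_nat n + 1) * a * ?H (Suc n) * ?H n)"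
    using legendre_clausen[OF assms, of n] by simp
  also have "\<dots> = ?H (Suc n) * (A * ?H (Suc n) - 4 * (1 + x) * a * (of_nat n + 1) * ?H n)"
    by (simp add: algebra_simps power2_eq_square)
  finally show ?thesis unfolding A_def .
qed

subsection \<open>The region of convergence\<close>

text \<open>The generating function is D^(-1/2), stated without a root. The recurrence says F' D =
  (a - b X) F, and D' = -2 (a - b X), so F^2 D has derivative 0.\<close>

lemma hom_legendre_fps:
  fixes a b :: complex
  defines "F \<equiv> Abs_fps (hom_legendre a b)"
  defines "D \<equiv> 1 - fps_const (2 * a) * fps_X + fps_const b * fps_X\<^sup>2"
  shows "F\<^sup>2 * D = 1"
proof -
  have F: "fps_deriv F * D = (fps_const a - fps_const b * fps_X) * F"
  proof (rule fps_ext)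
    fix n
    have D': "G * D = G - fps_const (2 * a) * (fps_X * G) + fps_const b * (fps_X * (fps_X * G))" for G
      unfolding D_def by (simp add: algebra_simps power2_eq_square)
    have F': "(fps_const a - fps_const b * fps_X) * F = fps_const a * F - fps_const b * (fps_X * F)"
      by (simp add: algebra_simps)
    consider "n = 0" | "n = 1" | m where "n = Suc (Suc m)"
      by (metis One_nat_def not0_implies_Suc)
    then show "fps_nth (fps_deriv F * D) n = fps_nth ((fps_const a - fps_const b * fps_X) * F) n"
    proof cases
      case 3
      show ?thesis
        using hom_legendre_rec[of "Suc m" a b]
        unfolding D' F' 3 by (simp add: F_def algebra_simps del: hom_legendre.simps)
    next
      case 1
      show ?thesis unfolding D' F' 1 by (simp add: F_def)
    next
      case 2
      show ?thesis
        using hom_legendre_rec[of 0 a b]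
        unfolding D' F' 2 by (simp add: F_def algebra_simps numeral_2_eq_2 del: hom_legendre.simps(3))
    qed
  qed
  have D'': "fps_deriv D = - 2 * (fps_const a - fps_const b * fps_X)"
    unfolding D_def by (simp add: power2_eq_square fps_const_mult[symmetric] algebra_simps numeral_fps_const del: fps_const_mult)
  have "fps_deriv (F\<^sup>2 * D) = 2 * F * (fps_deriv F * D) + F\<^sup>2 * fps_deriv D"
    by (simp add: power2_eq_square algebra_simps)
  also have "\<dots> = 0"
    unfolding F D'' by (simp add: power2_eq_square algebra_simps)
  finally have "F\<^sup>2 * D = fps_const (fps_nth (F\<^sup>2 * D) 0)"
    unfolding fps_deriv_eq_0_iff .
  also have "fps_nth (F\<^sup>2 * D) 0 = 1"
    by (simp add: F_def D_def power2_eq_square)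
  finally show ?thesis by simp
qed

text \<open>
  If \<open>norm \<mu> > \<theta>\<close>, the generating function \<open>F\<close> converges at \<open>1 / \<mu>\<close>, where the identity above reads \<open>0 = 1\<close>.
\<close>
lemma hom_legendre_root_bound:
  assumes "\<forall>\<^sub>F n in sequentially. norm (hom_legendre a b n) \<le> \<theta> ^ n"
    and "\<theta> > 0" and root: "\<mu>\<^sup>2 - 2 * a * \<mu> + b = 0"
  shows "norm \<mu> \<le> \<theta>"
proof (rule ccontr)
  assume "\<not> norm \<mu> \<le> \<theta>"
  then have mu: "norm \<mu> > \<theta>" "\<mu> \<noteq> 0" using \<open>\<theta> > 0\<close> by auto
  define F where "F = Abs_fps (hom_legendre a b)"
  define D where "D = 1 - fps_const (2 * a) * fps_X + fps_const b * fps_X\<^sup>2"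
  define u where "u = 1 / \<mu>"
  obtain r where r: "norm u < r" "r < 1 / \<theta>"
    using dense[of "norm u" "1 / \<theta>"] mu \<open>\<theta> > 0\<close> by (auto simp: u_def norm_divide frac_less2)
  have "r > 0" using r(1) norm_ge_zero[of u] by linarith
  have "summable (\<lambda>n. hom_legendre a b n * complex_of_real r ^ n)"
  proof (rule summable_comparison_test_ev)
    show "\<forall>\<^sub>F n in sequentially. norm (hom_legendre a b n * complex_of_real r ^ n) \<le> (\<theta> * r) ^ n"
      using assms(1) by eventually_elim
        (use \<open>r > 0\<close> in \<open>simp add: norm_mult norm_power power_mult_distrib mult_right_mono\<close>)
    show "summable (\<lambda>n. (\<theta> * r) ^ n)"
      using r \<open>r > 0\<close> \<open>\<theta> > 0\<close> by (intro summable_geometric) (simp add: field_simps)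
  qed
  then have "fps_conv_radius F \<ge> norm (complex_of_real r)"
    unfolding fps_conv_radius_def F_def by (intro conv_radius_geI) simp
  moreover have "norm (complex_of_real r) = r" using \<open>r > 0\<close> by simp
  ultimately have F: "ereal (norm u) < fps_conv_radius F"
    using r(1) by (metis ereal_less_eq(3) less_ereal.simps(1) order_less_le_trans)
  have D_poly: "D = fps_of_poly [:1, - 2 * a, b:]"
    unfolding D_def by (simp add: fps_of_poly_pCons power2_eq_square algebra_simps)
  have D: "fps_conv_radius D = \<infinity>" "eval_fps D u = 1 - 2 * a * u + b * u\<^sup>2"
    unfolding D_poly by (simp_all add: algebra_simps power2_eq_square)
  have F2: "ereal (norm u) < fps_conv_radius (F\<^sup>2)"
    using F fps_conv_radius_power[of F 2] by (rule order_less_le_trans)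
  have "eval_fps (F\<^sup>2 * D) u = eval_fps (F\<^sup>2) u * eval_fps D u"
    using F2 D(1) by (intro eval_fps_mult) auto
  also have "eval_fps D u = (\<mu>\<^sup>2 - 2 * a * \<mu> + b) / \<mu>\<^sup>2"
    unfolding D(2) unfolding u_def using mu by (simp add: field_simps power2_eq_square)
  also have "\<dots> = 0" using root by simp
  finally have "eval_fps (F\<^sup>2 * D) u = 0" by simp
  moreover have "F\<^sup>2 * D = 1" unfolding F_def D_def by (rule hom_legendre_fps)
  ultimately show False by simp
qed

text \<open>A nonconstant polynomial tends to infinity and a nonzero constant is its own bound. This
  keeps the elimination determinants away from 0 for large n, whatever their degree.\<close>

lemma quadratic_eventually_ge:
  fixes c0 c1 c2 :: complex
  assumes "\<not> (c0 = 0 \<and> c1 = 0 \<and> c2 = 0)"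
  shows "\<exists>\<epsilon>>0. \<forall>\<^sub>F n in sequentially. \<epsilon> \<le> norm (c0 + c1 * of_nat n + c2 * (of_nat n)\<^sup>2)"
proof (cases "c1 = 0 \<and> c2 = 0")
  case True
  then show ?thesis using assms by (intro exI[of _ "norm c0"]) simp
next
  case False
  define c where "c = (\<lambda>i::nat. if i = 0 then c0 else if i = 1 then c1 else c2)"
  have ex: "\<exists>k. k \<noteq> 0 \<and> k \<le> 2 \<and> c k \<noteq> 0"
  proof (cases "c1 = 0")
    case True
    then show ?thesis using False by (intro exI[of _ 2]) (simp add: c_def)
  qed (intro exI[of _ 1], simp add: c_def)
  then have "\<forall>\<^sub>F z in at_infinity. 1 \<le> norm (\<Sum>i\<le>2. c i * z ^ i)"
    by (rule polyfun_extremal)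
  then have "\<forall>\<^sub>F n in sequentially. 1 \<le> norm (\<Sum>i\<le>2. c i * of_nat n ^ i)"
    using tendsto_of_nat by (rule eventually_compose_filterlim)
  then show ?thesis
    by (intro exI[of _ 1]) (simp add: c_def numeral_2_eq_2)
qed

text \<open>Trades a factor n for a slightly larger base.\<close>

lemma eventually_linear_geometric_le:
  fixes C r s :: real
  assumes "0 < r" "r < s"
  shows "\<forall>\<^sub>F n in sequentially. C * of_nat n * r ^ n \<le> s ^ n"
proof -
  have "(\<lambda>n. of_nat n * (r / s) ^ n) \<longlonglongrightarrow> 0"
    using assms by (intro powser_times_n_limit_0) simp
  then have "(\<lambda>n. C * (of_nat n * (r / s) ^ n)) \<longlonglongrightarrow> 0"
    by (intro tendsto_mult_right_zero)
  then have "\<forall>\<^sub>F n in sequentially. C * (of_nat n * (r / s) ^ n) < 1"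
    by (rule order_tendstoD) simp
  then show ?thesis
    by eventually_elim (use assms in \<open>simp add: power_divide field_simps\<close>)
qed


text \<open>
  The \<open>n\<close>-th term is, up to a factor, \<open>H n * M n\<close>, so for large \<open>n\<close> one of the two factors is small. If it is not
  \<open>H n\<close>, then \<open>M n\<close> is small together with \<open>M (n + 1)\<close> or \<open>H (n + 1)\<close>; both are linear in \<open>H n\<close> and \<open>H (n - 1)\<close>,
  and the determinants \<open>D1\<close> and \<open>D2\<close> of the two linear systems are polynomials in \<open>n\<close> that never vanish
  identically, so \<open>H n\<close> is small in all cases.
\<close>
lemma summable_root_bound:
  fixes x a b \<mu> :: complex
  assumes x: "x \<noteq> -1" and b: "b \<noteq> 0" and ab: "a\<^sup>2 = (1 + 4 * x) * b"
    and root: "\<mu>\<^sup>2 - 2 * a * \<mu> + b = 0" and summ: "summable (series_term x)"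
  shows "norm (4 * x) * (norm \<mu>)\<^sup>2 \<le> norm b * (norm (1 + x))\<^sup>2"
proof (rule ccontr)
  assume contr: "\<not> ?thesis"
  define z where "z = x / (1 + x)\<^sup>2"
  have x1: "1 + x \<noteq> 0" using x by (metis add_eq_0_iff)
  have x0: "x \<noteq> 0" using contr by auto
  \<comment> \<open>Bounded terms give \<open>norm (H n * M n)\<close> \<le> 2 K n R^n. The negated
    claim says sqrt R < \<open>norm \<mu>\<close>, which leaves room for two intermediate bases:
    \<open>s\<close> absorbs the factor n of this estimate, \<open>s'\<close> the one lost in the
    elimination.\<close>
  define R where "R = norm b / norm (4 * z)"
  have zR: "norm (4 * z) > 0" "R > 0"
    using x0 x1 b by (simp_all add: R_def z_def)
  have "R = norm b * (norm (1 + x))\<^sup>2 / norm (4 * x)"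
    unfolding R_def z_def by (simp add: norm_mult norm_divide norm_power)
  moreover have "norm b * (norm (1 + x))\<^sup>2 < (norm \<mu>)\<^sup>2 * norm (4 * x)"
    using contr by (simp add: mult.commute not_le)
  ultimately have "R < (norm \<mu>)\<^sup>2"
    using x0 by (simp add: pos_divide_less_eq)
  then have "sqrt R < norm \<mu>"
    using real_sqrt_less_mono by fastforce
  then obtain s where s: "sqrt R < s" "s < norm \<mu>" using dense by blast
  then obtain s' where s': "s < s'" "s' < norm \<mu>" using dense by blast
  have spos: "s > 0" using s(1) zR(2) real_sqrt_gt_zero[of R] by linarith
  have Rs: "R < s\<^sup>2"
    using s(1) spos zR(2) by (metis abs_of_pos real_sqrt_abs real_sqrt_less_iff)
  define \<alpha> \<delta> \<tau> e where "\<alpha> = 2 * x * (3 + 4 * x)" and "\<delta> = 1 + 18 * x + 21 * x\<^sup>2"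
    and "\<tau> = 4 * (1 + x) * (1 + 4 * x)" and "e = 4 * (1 + x) * a"
  define H where "H = hom_legendre a b"
  define M where "M n = (\<alpha> + of_nat n * \<delta>) * H n - of_nat n * e * H (n - 1)" for n
  \<comment> \<open>These relations remove a from the determinants, which then depend on x and n
    only, up to the factor b.\<close>
  have ea: "e * a = \<tau> * b" "e * e = 4 * (1 + x) * \<tau> * b"
    unfolding e_def \<tau>_def using ab by algebra+

  obtain K where K: "K > 0" "\<And>n. norm (series_term x n) \<le> K"
    using summable_imp_Bseq[OF summ] by (auto elim: BseqE)
  have small: "\<forall>\<^sub>F n in sequentially. norm (H n) \<le> s ^ n \<or> norm (M n) \<le> s ^ n"
  proof -
    have "\<forall>\<^sub>F n in sequentially. 2 * K * of_nat n * R ^ n \<le> (s\<^sup>2) ^ n"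
      using zR(2) Rs by (rule eventually_linear_geometric_le)
    then show ?thesis
      using eventually_gt_at_top[of 0]
    proof eventually_elim
      case (elim n)
      obtain m where m: "n = Suc m" using elim(2) by (metis gr0_implies_Suc)
      have "b ^ n * inner_sum x n = H n * M n"
        unfolding m inner_sum_hom_legendre[OF ab] H_def M_def \<alpha>_def \<delta>_def e_def
        by (simp add: algebra_simps)
      then have HM: "norm (H n * M n) = norm b ^ n * norm (inner_sum x n)"
        by (metis norm_mult norm_power)
      have "4 ^ n / (2 * real n) * (norm z ^ n * norm (inner_sum x n))
          \<le> real (2 * n choose n) * (norm z ^ n * norm (inner_sum x n))"
        using central_binomial_lower_bound[OF elim(2)] by (intro mult_right_mono) auto
      also have "\<dots> = norm (series_term x n)"
        unfolding series_term_def z_def by (simp add: norm_mult norm_power norm_divide)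
      also have "\<dots> \<le> K" by (rule K)
      finally have "norm (4 * z) ^ n * norm (inner_sum x n) \<le> 2 * K * n"
        using elim(2) by (simp add: norm_mult power_mult_distrib field_simps)
      then have "norm (H n * M n) \<le> norm b ^ n * (2 * K * n / norm (4 * z) ^ n)"
        unfolding HM using zR(1) by (intro mult_left_mono) (simp_all add: field_simps)
      also have "\<dots> = 2 * K * n * R ^ n"
        unfolding R_def by (simp add: power_divide)
      also have "\<dots> \<le> s ^ n * s ^ n"
        using elim(1) by (simp add: power_mult_distrib power2_eq_square)
      finally have "norm (H n) * norm (M n) \<le> s ^ n * s ^ n" by (simp add: norm_mult)
      then show ?case
        using spos by (meson linorder_not_le mult_strict_mono' norm_ge_zero zero_le_power less_imp_le)
    qed
  qed

  define D1 where "D1 N = - (\<alpha> + N * \<delta>) * (\<alpha> + (N + 1) * \<delta>)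
      + (2 * N + 1) * \<tau> * (\<alpha> + (N + 1) * \<delta>) - 4 * (N + 1)\<^sup>2 * (1 + x) * \<tau>" for N :: complex
  define D2 where "D2 N = (2 * N + 1) * \<tau> - (\<alpha> + N * \<delta>)" for N :: complex
  obtain \<epsilon>1 where e1: "\<epsilon>1 > 0" "\<forall>\<^sub>F n in sequentially. \<epsilon>1 \<le> norm (D1 (of_nat n))"
  proof -
    define c0 c1 c2 where "c0 = 232 * x ^ 4 + 534 * x ^ 3 + 316 * x\<^sup>2 + 14 * x - 12"
      and "c1 = 487 * x ^ 4 + 1212 * x ^ 3 + 798 * x\<^sup>2 + 84 * x - 21"
      and "c2 = 231 * x ^ 4 + 596 * x ^ 3 + 410 * x\<^sup>2 + 52 * x - 9"
    have "\<not> (c0 = 0 \<and> c1 = 0 \<and> c2 = 0)"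
    proof
      assume c: "c0 = 0 \<and> c1 = 0 \<and> c2 = 0"
      \<comment> \<open>At a zero of any of these factors \<open>c0\<close> and \<open>c1\<close> do
        not both vanish, so \<open>D1\<close> is never the zero polynomial in n.\<close>
      have "c2 = (3 * x + 1) * (11 * x + 9) * (7 * x\<^sup>2 + 10 * x - 1)"
        unfolding c2_def by (simp add: algebra_simps power2_eq_square power3_eq_cube power4_eq_xxxx)
      with c consider "3 * x + 1 = 0" | "11 * x + 9 = 0" | "7 * x\<^sup>2 + 10 * x - 1 = 0" by auto
      then show False
        using c unfolding c0_def by cases algebra+
    qed
    then obtain \<epsilon> where "\<epsilon> > 0" "\<forall>\<^sub>F n in sequentially. \<epsilon> \<le> norm (c0 + c1 * of_nat n + c2 * (of_nat n)\<^sup>2)"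
      using quadratic_eventually_ge by blast
    moreover have "c0 + c1 * N + c2 * N\<^sup>2 = D1 N" for N
      unfolding c0_def c1_def c2_def D1_def \<alpha>_def \<delta>_def \<tau>_def by algebra
    ultimately show ?thesis using that by simp
  qed
  obtain \<epsilon>2 where e2: "\<epsilon>2 > 0" "\<forall>\<^sub>F n in sequentially. \<epsilon>2 \<le> norm (D2 (of_nat n))"
  proof -
    define c0 c1 where "c0 = 8 * x\<^sup>2 + 14 * x + 4" and "c1 = 11 * x\<^sup>2 + 22 * x + 7"
    have "\<not> (c0 = 0 \<and> c1 = 0 \<and> (0 :: complex) = 0)"
      unfolding c0_def c1_def by algebra
    then obtain \<epsilon> where "\<epsilon> > 0" "\<forall>\<^sub>F n in sequentially. \<epsilon> \<le> norm (c0 + c1 * of_nat n + 0 * (of_nat n)\<^sup>2)"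
      using quadratic_eventually_ge by blast
    moreover have "c0 + c1 * N + 0 * N\<^sup>2 = D2 N" for N
      unfolding c0_def c1_def D2_def \<alpha>_def \<delta>_def \<tau>_def by algebra
    ultimately show ?thesis using that by simp
  qed

  \<comment> \<open>Here \<open>h0\<close>, \<open>h1\<close>, \<open>h2\<close> stand for H at n -
    1, n, n + 1. The recurrence removes \<open>h0\<close> and leaves \<open>h1\<close> in terms of
    the quantities assumed small: two values of M, or M at n and H at n + 1.\<close>
  have elim1: "b * D1 N * h1 = - A2 * b * (A1 * h1 - N * e * h0) + e * (N + 1) * (A2 * h2 - (N + 1) * e * h1)"
    and elim2: "b * D2 N * h1 = - b * (A1 * h1 - N * e * h0) + e * (N + 1) * h2"
    if "A1 = \<alpha> + N * \<delta>" "A2 = \<alpha> + (N + 1) * \<delta>" "(N + 1) * h2 = (2 * N + 1) * a * h1 - N * b * h0"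
    for N h0 h1 h2 A1 A2
  proof -
    have "- A2 * b * (A1 * h1 - N * e * h0) + e * (N + 1) * (A2 * h2 - (N + 1) * e * h1)
       = - A2 * b * (A1 * h1 - N * e * h0) + e * A2 * ((N + 1) * h2) - (N + 1) * (N + 1) * (e * e) * h1"
      by (simp add: algebra_simps)
    also have "\<dots> = - A2 * b * A1 * h1 + (2 * N + 1) * A2 * (e * a) * h1 - (N + 1) * (N + 1) * (e * e) * h1"
      unfolding that(3) by (simp add: algebra_simps)
    also have "\<dots> = b * D1 N * h1"
      unfolding ea D1_def that(1,2) by (simp add: algebra_simps power2_eq_square)
    finally show "b * D1 N * h1 = - A2 * b * (A1 * h1 - N * e * h0) + e * (N + 1) * (A2 * h2 - (N + 1) * e * h1)" ..
    have "- b * (A1 * h1 - N * e * h0) + e * (N + 1) * h2 = - b * (A1 * h1 - N * e * h0) + e * ((N + 1) * h2)"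
      by (simp add: algebra_simps)
    also have "\<dots> = - b * A1 * h1 + (2 * N + 1) * (e * a) * h1"
      unfolding that(3) by (simp add: algebra_simps)
    also have "\<dots> = b * D2 N * h1"
      unfolding ea D2_def that(1) by (simp add: algebra_simps)
    finally show "b * D2 N * h1 = - b * (A1 * h1 - N * e * h0) + e * (N + 1) * h2" ..
  qed

  define \<epsilon> where "\<epsilon> = min \<epsilon>1 \<epsilon>2 * norm b"
  define B where "B = (norm \<alpha> + norm \<delta> + 1) * norm b + norm e"
  have eps: "\<epsilon> > 0" using e1 e2 b by (simp add: \<epsilon>_def)
  have B0: "B \<ge> 0" unfolding B_def by (intro add_nonneg_nonneg mult_nonneg_nonneg) auto
  \<comment> \<open>Large enough for both outcomes, H n \<le> s^n and the estimate
    \<open>key\<close>; the factor 2 comes from n + 1 \<le> 2 n.\<close>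
  define C where "C = 2 * (1 + B * (1 + s) / \<epsilon>)"
  have "\<forall>\<^sub>F n in sequentially. norm (H n) \<le> C * of_nat n * s ^ n"
    using small small[THEN sequentially_offset, of 1] e1(2) e2(2) eventually_gt_at_top[of 0]
  proof eventually_elim
    case (elim n)
    obtain m where m: "n = Suc m" using elim(5) by (metis gr0_implies_Suc)
    define N where "N = (of_nat n :: complex)"
    define A1 A2 where "A1 = \<alpha> + N * \<delta>" and "A2 = \<alpha> + (N + 1) * \<delta>"
    have rec: "(N + 1) * H (Suc n) = (2 * N + 1) * a * H n - N * b * H m"
      using hom_legendre_rec[of m a b] unfolding H_def N_def m by (simp add: algebra_simps del: hom_legendre.simps)
    have M1: "M n = A1 * H n - N * e * H m"
      unfolding M_def A1_def N_def m by simp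
    have M2: "M (Suc n) = A2 * H (Suc n) - (N + 1) * e * H n"
      unfolding M_def A2_def N_def by (simp add: algebra_simps)
    have eq1: "b * D1 N * H n = - A2 * b * M n + e * (N + 1) * M (Suc n)"
      unfolding M1 M2 by (rule elim1[OF A1_def A2_def rec])
    have eq2: "b * D2 N * H n = - b * M n + e * (N + 1) * H (Suc n)"
      unfolding M1 by (rule elim2[OF A1_def A2_def rec])
    have N1: "norm (N + 1) = real n + 1"
      unfolding N_def by (metis norm_of_nat of_nat_1 of_nat_add)
    have A2: "norm A2 \<le> (norm \<alpha> + norm \<delta>) * (real n + 1)"
    proof -
      have "norm A2 \<le> norm \<alpha> + (real n + 1) * norm \<delta>"
        unfolding A2_def using norm_triangle_ineq[of \<alpha> "(N + 1) * \<delta>"] by (simp only: norm_mult N1)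
      also have "\<dots> \<le> (norm \<alpha> + norm \<delta>) * (real n + 1)" by (simp add: algebra_simps)
      finally show ?thesis .
    qed
    \<comment> \<open>One estimate for both eliminations: (d, u, v) is (\<open>D1 N\<close>,
      \<open>A2 * b\<close>, \<open>M (Suc n)\<close>) or (\<open>D2 N\<close>, \<open>b\<close>,
      \<open>H (Suc n)\<close>).\<close>
    have key: "norm (H n) \<le> B * (1 + s) / \<epsilon> * (real n + 1) * s ^ n"
      if d: "\<epsilon> \<le> norm (b * d)" and eq: "b * d * H n = - u * M n + e * (N + 1) * v"
        and u: "norm u \<le> (norm \<alpha> + norm \<delta> + 1) * norm b * (real n + 1)"
        and Mn: "norm (M n) \<le> s ^ n" and v: "norm v \<le> s ^ Suc n" for d u v
    proof -
      have "\<epsilon> * norm (H n) \<le> norm (b * d) * norm (H n)"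
        using d by (intro mult_right_mono) auto
      also have "\<dots> = norm (- u * M n + e * (N + 1) * v)"
        by (metis eq norm_mult)
      also have "\<dots> \<le> norm u * norm (M n) + norm e * (real n + 1) * norm v"
        using norm_triangle_ineq[of "- u * M n" "e * (N + 1) * v"] by (simp add: norm_mult N1)
      also have "\<dots> \<le> ((norm \<alpha> + norm \<delta> + 1) * norm b * (real n + 1)) * s ^ n + norm e * (real n + 1) * s ^ Suc n"
        using u Mn v spos by (intro add_mono mult_mono mult_nonneg_nonneg) auto
      also have "\<dots> \<le> B * (1 + s) * (real n + 1) * s ^ n"
      proof -
        have "B * (1 + s) * (real n + 1) * s ^ n - (((norm \<alpha> + norm \<delta> + 1) * norm b * (real n + 1)) * s ^ n + norm e * (real n + 1) * s ^ Suc n)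
          = (norm e + (norm \<alpha> + norm \<delta> + 1) * norm b * s) * ((real n + 1) * s ^ n)"
          unfolding B_def by (simp add: algebra_simps)
        also have "\<dots> \<ge> 0" using spos by (intro mult_nonneg_nonneg add_nonneg_nonneg) auto
        finally show ?thesis by linarith
      qed
      finally show ?thesis using eps by (simp add: field_simps)
    qed
    have "norm (H n) \<le> s ^ n \<or> norm (H n) \<le> B * (1 + s) / \<epsilon> * (real n + 1) * s ^ n"
    proof (rule disjCI)
      assume "\<not> norm (H n) \<le> B * (1 + s) / \<epsilon> * (real n + 1) * s ^ n"
      note contra = this
      show "norm (H n) \<le> s ^ n"
      proof (rule ccontr)
        assume "\<not> norm (H n) \<le> s ^ n"
        then have Mn: "norm (M n) \<le> s ^ n" using elim(1) by blast
        have u1: "norm (A2 * b) \<le> (norm \<alpha> + norm \<delta> + 1) * norm b * (real n + 1)"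
        proof -
          have "norm (A2 * b) \<le> (norm \<alpha> + norm \<delta>) * (real n + 1) * norm b"
            unfolding norm_mult using A2 by (intro mult_right_mono) auto
          also have "\<dots> \<le> (norm \<alpha> + norm \<delta> + 1) * (real n + 1) * norm b"
            by (intro mult_right_mono) auto
          finally show ?thesis by (simp add: mult_ac)
        qed
        have u2: "norm b \<le> (norm \<alpha> + norm \<delta> + 1) * norm b * (real n + 1)"
        proof -
          have "norm b * (1 * 1) \<le> norm b * ((norm \<alpha> + norm \<delta> + 1) * (real n + 1))"
            by (intro mult_left_mono mult_mono) auto
          then show ?thesis by (simp add: mult_ac)
        qed
        have d1: "\<epsilon> \<le> norm (b * D1 N)" "\<epsilon> \<le> norm (b * D2 N)"
          unfolding \<epsilon>_def norm_mult mult.commute[of _ "norm b"] N_def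
          using elim(3,4) by (auto intro!: mult_left_mono)
        from elim(2) have "norm (H (Suc n)) \<le> s ^ Suc n \<or> norm (M (Suc n)) \<le> s ^ Suc n" by simp
        then show False
        proof
          assume "norm (M (Suc n)) \<le> s ^ Suc n"
          then have "norm (H n) \<le> B * (1 + s) / \<epsilon> * (real n + 1) * s ^ n"
            by (rule key[OF d1(1) _ u1 Mn, rotated]) (use eq1 in simp)
          then show False using contra by blast
        next
          assume "norm (H (Suc n)) \<le> s ^ Suc n"
          then have "norm (H n) \<le> B * (1 + s) / \<epsilon> * (real n + 1) * s ^ n"
            by (rule key[OF d1(2) _ u2 Mn, rotated]) (use eq2 in simp)
          then show False using contra by blast
        qed
      qed
    qed
    moreover have "s ^ n \<le> C * real n * s ^ n"
    proof -
      have "1 * 1 \<le> C * real n"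
        using elim(5) B0 spos eps by (intro mult_mono) (auto simp: C_def)
      then show ?thesis using spos by simp
    qed
    moreover have "B * (1 + s) / \<epsilon> * (real n + 1) * s ^ n \<le> C * real n * s ^ n"
    proof -
      have "B * (1 + s) / \<epsilon> * (real n + 1) \<le> (1 + B * (1 + s) / \<epsilon>) * (2 * real n)"
        using elim(5) B0 spos eps by (intro mult_mono) auto
      then have "B * (1 + s) / \<epsilon> * (real n + 1) * s ^ n \<le> (1 + B * (1 + s) / \<epsilon>) * (2 * real n) * s ^ n"
        using spos by (intro mult_right_mono) auto
      then show ?thesis by (simp only: C_def mult_ac)
    qed
    ultimately show ?case by linarith
  qed
  moreover have "\<forall>\<^sub>F n in sequentially. C * of_nat n * s ^ n \<le> s' ^ n"
    using spos s'(1) by (rule eventually_linear_geometric_le)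
  ultimately have "\<forall>\<^sub>F n in sequentially. norm (hom_legendre a b n) \<le> s' ^ n"
    unfolding H_def by eventually_elim linarith
  then have "norm \<mu> \<le> s'"
    using spos s'(1) root by (intro hom_legendre_root_bound[of a b]) auto
  then show False using s'(2) by simp
qed

subsection \<open>An upper bound from Laplace's integral\<close>

text \<open>Laplace's first integral; for a = 1 and b = 1 - w^2 the root of a^2 - b is w itself. The
  integrals obey the Legendre recurrence because the corresponding combination of integrands is the
  derivative of w sin t (1 + w cos t)^(n+1), which vanishes at 0 and pi.\<close>

lemma hom_legendre_has_integral:
  fixes w :: complex
  shows "((\<lambda>t. (1 + w * cos (of_real t)) ^ n) has_integral of_real pi * hom_legendre 1 (1 - w\<^sup>2) n) {0..pi}"
proof (induction n rule: induct_nat_012)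
  case 0
  show ?case using has_integral_const_real[of "1 :: complex" 0 pi] by (simp add: scaleR_conv_of_real)
next
  case 1
  have "((\<lambda>t. 1 + w * cos (of_real t)) has_integral
          (of_real pi + w * sin (of_real pi)) - (of_real 0 + w * sin (of_real 0))) {0..pi}"
  proof (rule fundamental_theorem_of_calculus)
    fix t assume "t \<in> {0..pi}"
    show "((\<lambda>t. of_real t + w * sin (of_real t)) has_vector_derivative 1 + w * cos (of_real t)) (at t within {0..pi})"
      by (rule has_vector_derivative_real_field) (auto intro!: derivative_eq_intros)
  qed simp
  then show ?case by (simp flip: sin_of_real)
next
  case (ge2 n)
  define N where "N = (of_nat n :: complex)"
  define u where "u = (\<lambda>z::complex. 1 + w * cos z)"
  let ?T = "hom_legendre 1 (1 - w\<^sup>2)"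
  have "((\<lambda>t. (N + 2) * u (of_real t) ^ Suc (Suc n) - (2 * N + 3) * u (of_real t) ^ Suc n
        + (N + 1) * (1 - w\<^sup>2) * u (of_real t) ^ n) has_integral
        w * sin (of_real pi) * u (of_real pi) ^ Suc n - w * sin (of_real 0) * u (of_real 0) ^ Suc n) {0..pi}"
  proof (rule fundamental_theorem_of_calculus)
    fix t assume "t \<in> {0..pi}"
    have "((\<lambda>z. w * sin z * u z ^ Suc n) has_field_derivative
        (N + 2) * u z ^ Suc (Suc n) - (2 * N + 3) * u z ^ Suc n + (N + 1) * (1 - w\<^sup>2) * u z ^ n) (at z)" for z
    proof -
      have "(u has_field_derivative - (w * sin z)) (at z)"
        unfolding u_def by (auto intro!: derivative_eq_intros)
      then have p: "((\<lambda>z. u z ^ Suc n) has_field_derivative (1 + N) * (- (w * sin z) * u z ^ n)) (at z)"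
        unfolding N_def by (rule DERIV_power_Suc)
      have q: "((\<lambda>z. w * sin z) has_field_derivative w * cos z) (at z)"
        by (auto intro!: derivative_eq_intros)
      have "((\<lambda>z. w * sin z * u z ^ Suc n) has_field_derivative
         w * cos z * u z ^ Suc n + w * sin z * ((N + 1) * u z ^ n * - (w * sin z))) (at z)"
        by (rule DERIV_cong[OF DERIV_mult[OF q p]]) (simp add: algebra_simps)
      also have "w * cos z * u z ^ Suc n + w * sin z * ((N + 1) * u z ^ n * - (w * sin z))
          = u z ^ n * ((u z - 1) * u z - (N + 1) * (w\<^sup>2 * (sin z)\<^sup>2))"
        by (simp add: u_def power2_eq_square algebra_simps)
      also have "w\<^sup>2 * (sin z)\<^sup>2 = w\<^sup>2 - (u z - 1)\<^sup>2"
        unfolding sin_squared_eq u_def by (simp add: power_mult_distrib algebra_simps)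
      also have "u z ^ n * ((u z - 1) * u z - (N + 1) * (w\<^sup>2 - (u z - 1)\<^sup>2))
          = (N + 2) * u z ^ Suc (Suc n) - (2 * N + 3) * u z ^ Suc n + (N + 1) * (1 - w\<^sup>2) * u z ^ n"
        by (simp add: power2_eq_square algebra_simps)
      finally show ?thesis .
    qed
    then show "((\<lambda>t. w * sin (of_real t) * u (of_real t) ^ Suc n) has_vector_derivative
        (N + 2) * u (of_real t) ^ Suc (Suc n) - (2 * N + 3) * u (of_real t) ^ Suc n
        + (N + 1) * (1 - w\<^sup>2) * u (of_real t) ^ n) (at t within {0..pi})"
      by (rule has_vector_derivative_real_field)
  qed simp
  then have "((\<lambda>t. (N + 2) * u (of_real t) ^ Suc (Suc n) - (2 * N + 3) * u (of_real t) ^ Suc n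
        + (N + 1) * (1 - w\<^sup>2) * u (of_real t) ^ n) has_integral 0) {0..pi}"
    by (simp flip: sin_of_real)
  moreover have "((\<lambda>t. (2 * N + 3) * u (of_real t) ^ Suc n - (N + 1) * (1 - w\<^sup>2) * u (of_real t) ^ n)
      has_integral (2 * N + 3) * (of_real pi * ?T (Suc n)) - (N + 1) * (1 - w\<^sup>2) * (of_real pi * ?T n)) {0..pi}"
    using ge2 unfolding u_def by (intro has_integral_diff has_integral_mult_right)
  ultimately have "((\<lambda>t. (N + 2) * u (of_real t) ^ Suc (Suc n)) has_integral
      (2 * N + 3) * (of_real pi * ?T (Suc n)) - (N + 1) * (1 - w\<^sup>2) * (of_real pi * ?T n)) {0..pi}"
    by (rule has_integral_add[where k = 0, THEN has_integral_eq_rhs, THEN has_integral_eq[rotated]]) simp_all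
  also have "(2 * N + 3) * (of_real pi * ?T (Suc n)) - (N + 1) * (1 - w\<^sup>2) * (of_real pi * ?T n)
      = (N + 2) * (of_real pi * ?T (Suc (Suc n)))"
    using hom_legendre_rec[of n 1 "1 - w\<^sup>2"] unfolding N_def[symmetric] by algebra
  finally have "((\<lambda>t. inverse (N + 2) * ((N + 2) * u (of_real t) ^ Suc (Suc n))) has_integral
      inverse (N + 2) * ((N + 2) * (of_real pi * ?T (Suc (Suc n))))) {0..pi}"
    by (rule has_integral_mult_right)
  moreover have "N + 2 \<noteq> 0" unfolding N_def by (rule of_nat_add_nonzero)
  ultimately show ?case by (simp add: u_def mult.assoc[symmetric] del: hom_legendre.simps)
qed

text \<open>For c = cos t this bounds Laplace's integrand by its value at t = 0 with an explicit
  loss in sin^2 t. The slack is exactly 2 Re w (1 - c), which is where the choice of the half-plane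
  enters.\<close>

lemma norm_one_add_mult_le:
  fixes w :: complex and c :: real
  assumes "Re w \<ge> 0" "\<bar>c\<bar> \<le> 1"
  shows "(norm (1 + w * of_real c))\<^sup>2 \<le> (norm (1 + w))\<^sup>2 - (norm w)\<^sup>2 * (1 - c\<^sup>2)"
proof -
  have "(norm (1 + w))\<^sup>2 - (norm w)\<^sup>2 * (1 - c\<^sup>2) - (norm (1 + w * of_real c))\<^sup>2 = 2 * Re w * (1 - c)"
    unfolding cmod_power2 by (simp add: power2_eq_square algebra_simps)
  also have "\<dots> \<ge> 0" using assms by simp
  finally show ?thesis by linarith
qed

text \<open>Jordan's inequality: by concavity sin lies above its chord.\<close>

lemma sin_ge_linear:
  fixes t :: real
  assumes "0 \<le> t" "t \<le> pi / 2"
  shows "2 * t / pi \<le> sin t"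
proof -
  have "concave_on {0..pi} sin"
  proof (rule f''_le0_imp_concave[where f' = cos and f'' = "\<lambda>x. - sin x"])
    show "- sin x \<le> 0" if "x \<in> {0..pi}" for x :: real using that by (simp add: sin_ge_zero)
  qed (auto intro!: derivative_eq_intros)
  then have "(1 - 2 * t / pi) * sin 0 + (2 * t / pi) * sin (pi / 2) \<le> sin ((1 - 2 * t / pi) *\<^sub>R 0 + (2 * t / pi) *\<^sub>R (pi / 2))"
    by (rule concave_onD) (use assms in \<open>auto simp: field_simps\<close>)
  then show ?thesis by simp
qed

text \<open>Laplace's method with an explicit constant: the integrand is at most
  \<open>norm (1 + w) ^ n\<close> times a Gaussian in sin t, and exp (-u) \<le> 1 / (1 + u) makes
  the majorant integrable by arctan. The gain 1 / sqrt n over the trivial bound is essential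
  later.\<close>

lemma hom_legendre_norm_le:
  fixes w :: complex
  assumes w: "Re w \<ge> 0" "w \<noteq> 0" and "n > 0"
  shows "norm (hom_legendre 1 (1 - w\<^sup>2) n) \<le> norm (1 + w) ^ n * (pi * norm (1 + w) / (norm w * sqrt n))"
proof -
  have "Re (1 + w) > 0" using w by simp
  then have "1 + w \<noteq> 0" by (metis less_irrefl zero_complex.sel(1))
  then have w1: "norm (1 + w) > 0" by simp
  define k where "k = (norm w)\<^sup>2 / (norm (1 + w))\<^sup>2"
  have k: "k > 0" using w w1 by (simp add: k_def)
  \<comment> \<open>The factor 4 / pi^2 is the square of Jordan's constant.\<close>
  define b where "b = n * k / 2 * (4 / pi\<^sup>2)"
  have b: "b > 0" using k \<open>n > 0\<close> by (simp add: b_def)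
  \<comment> \<open>Two bumps, because sin t is small at both ends; for Re w = 0 the integrand
    really is equally large at 0 and pi.\<close>
  define g where "g = (\<lambda>t. norm (1 + w) ^ n * (1 / (1 + b * t\<^sup>2) + 1 / (1 + b * (pi - t)\<^sup>2)))"
  have pointwise: "norm ((1 + w * cos (of_real t)) ^ n) \<le> g t" if t: "t \<in> {0..pi}" for t
  proof -
    have "(norm (1 + w * of_real (cos t)))\<^sup>2 \<le> (norm (1 + w))\<^sup>2 - (norm w)\<^sup>2 * (1 - (cos t)\<^sup>2)"
      using w by (intro norm_one_add_mult_le) auto
    also have "\<dots> = (norm (1 + w))\<^sup>2 * (1 - k * (sin t)\<^sup>2)"
      using w1 by (simp add: k_def sin_squared_eq field_simps)
    also have "\<dots> \<le> (norm (1 + w))\<^sup>2 * exp (- k * (sin t)\<^sup>2)"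
      using exp_ge_add_one_self[of "- k * (sin t)\<^sup>2"] by (intro mult_left_mono) auto
    also have "\<dots> = (norm (1 + w) * exp (- k * (sin t)\<^sup>2 / 2))\<^sup>2"
      by (simp add: power_mult_distrib exp_double[symmetric])
    finally have "norm (1 + w * of_real (cos t)) \<le> norm (1 + w) * exp (- k * (sin t)\<^sup>2 / 2)"
      by (rule power2_le_imp_le) simp
    then have "norm (1 + w * of_real (cos t)) ^ n \<le> (norm (1 + w) * exp (- k * (sin t)\<^sup>2 / 2)) ^ n"
      by (intro power_mono) auto
    also have "\<dots> = norm (1 + w) ^ n * exp (- (n * k / 2 * (sin t)\<^sup>2))"
      by (simp add: power_mult_distrib exp_of_nat_mult[symmetric] mult_ac)
    also have "exp (- (n * k / 2 * (sin t)\<^sup>2)) \<le> 1 / (1 + n * k / 2 * (sin t)\<^sup>2)"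
    proof -
      have "1 + n * k / 2 * (sin t)\<^sup>2 \<le> exp (n * k / 2 * (sin t)\<^sup>2)" by (rule exp_ge_add_one_self)
      moreover have "1 + n * k / 2 * (sin t)\<^sup>2 > 0" using k by (intro add_pos_nonneg mult_nonneg_nonneg) auto
      ultimately show ?thesis unfolding exp_minus by (simp add: inverse_eq_divide frac_le)
    qed
    also have "1 / (1 + n * k / 2 * (sin t)\<^sup>2) \<le> 1 / (1 + b * t\<^sup>2) + 1 / (1 + b * (pi - t)\<^sup>2)"
    proof -
      have *: "1 / (1 + n * k / 2 * (sin s)\<^sup>2) \<le> 1 / (1 + b * s\<^sup>2)" if "0 \<le> s" "s \<le> pi / 2" for s
      proof -
        have "(2 * s / pi)\<^sup>2 \<le> (sin s)\<^sup>2"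
          using that sin_ge_linear[of s] by (intro power_mono) auto
        then have "n * k / 2 * (2 * s / pi)\<^sup>2 \<le> n * k / 2 * (sin s)\<^sup>2"
          using k by (intro mult_left_mono) auto
        then have "b * s\<^sup>2 \<le> n * k / 2 * (sin s)\<^sup>2"
          by (simp add: b_def power_divide power_mult_distrib)
        moreover have "b * s\<^sup>2 \<ge> 0" using b by simp
        ultimately show ?thesis by (intro divide_left_mono mult_pos_pos) auto
      qed
      have nn: "0 \<le> 1 / (1 + b * s\<^sup>2)" for s using b by (intro divide_nonneg_nonneg add_nonneg_nonneg) auto
      show ?thesis
      proof (cases "t \<le> pi / 2")
        case True
        then show ?thesis using *[of t] nn[of "pi - t"] t unfolding atLeastAtMost_iff by linarith
      next
        case False
        then show ?thesis
          using *[of "pi - t"] nn[of t] t unfolding atLeastAtMost_iff sin_pi_minus by linarith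
      qed
    qed
    finally show ?thesis
      using w1 by (simp add: g_def norm_power mult_left_mono flip: cos_of_real)
  qed
  define G where "G = (\<lambda>t. norm (1 + w) ^ n * ((arctan (sqrt b * t) - arctan (sqrt b * (pi - t))) / sqrt b))"
  have "(g has_integral (G pi - G 0)) {0..pi}"
  proof (rule fundamental_theorem_of_calculus)
    fix t assume "t \<in> {0..pi}"
    have "((\<lambda>t. arctan (sqrt b * t)) has_real_derivative sqrt b / (1 + b * t\<^sup>2)) (at t within {0..pi})"
      "((\<lambda>t. arctan (sqrt b * (pi - t))) has_real_derivative - (sqrt b / (1 + b * (pi - t)\<^sup>2))) (at t within {0..pi})"
      using b by (auto intro!: derivative_eq_intros simp: power_mult_distrib inverse_eq_divide)
    then have "(G has_real_derivative norm (1 + w) ^ n *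
        ((sqrt b / (1 + b * t\<^sup>2) - - (sqrt b / (1 + b * (pi - t)\<^sup>2))) / sqrt b)) (at t within {0..pi})"
      unfolding G_def by (intro DERIV_cmult DERIV_cdivide DERIV_diff)
    then have "(G has_real_derivative g t) (at t within {0..pi})"
      using b unfolding g_def by (simp add: add_divide_distrib)
    then show "(G has_vector_derivative g t) (at t within {0..pi})"
      by (simp add: has_real_derivative_iff_has_vector_derivative)
  qed simp
  moreover have "((\<lambda>t. (1 + w * cos (of_real t)) ^ n) has_integral of_real pi * hom_legendre 1 (1 - w\<^sup>2) n) {0..pi}"
    by (rule hom_legendre_has_integral)
  ultimately have "norm (of_real pi * hom_legendre 1 (1 - w\<^sup>2) n) \<le> G pi - G 0"
    using pointwise by (metis (no_types, lifting) has_integral_iff integral_norm_bound_integral)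
  also have "\<dots> = norm (1 + w) ^ n * (2 * arctan (sqrt b * pi) / sqrt b)"
    by (simp add: G_def algebra_simps)
  also have "\<dots> \<le> norm (1 + w) ^ n * (pi / sqrt b)"
    using b arctan_ubound[of "sqrt b * pi"] by (intro mult_left_mono divide_right_mono) auto
  finally have "pi * norm (hom_legendre 1 (1 - w\<^sup>2) n) \<le> pi * (norm (1 + w) ^ n * (1 / sqrt b))"
    by (simp add: norm_mult mult_ac)
  then have "norm (hom_legendre 1 (1 - w\<^sup>2) n) \<le> norm (1 + w) ^ n * (1 / sqrt b)"
    using pi_gt_zero by (rule mult_le_cancel_left_pos[THEN iffD1, rotated])
  also have "1 / sqrt b = pi * norm (1 + w) / (norm w * sqrt (2 * n))"
    using w1 by (simp add: b_def k_def real_sqrt_mult real_sqrt_divide field_simps)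
  also have "\<dots> \<le> pi * norm (1 + w) / (norm w * sqrt n)"
    using w \<open>n > 0\<close> by (intro divide_left_mono mult_left_mono mult_pos_pos) auto
  finally show ?thesis by (simp add: mult_left_mono)
qed

subsection \<open>The differential equation of the partial sums\<close>

abbreviation ray_legendre :: "complex \<Rightarrow> nat \<Rightarrow> complex" where
  "ray_legendre w n \<equiv> hom_legendre 1 (1 - w\<^sup>2) n"

text \<open>With u = 1 + w cos t one has w d/dw u^n = n (u^n - u^(n-1)), so Laplace's integral
  suggests the formula; induction along the recurrence avoids differentiating under the integral.
  The truncated \<open>n - 1\<close> at n = 0 is multiplied by 0.\<close>

lemma ray_legendre_deriv:
  assumes "w \<noteq> 0"
  shows "((\<lambda>w. ray_legendre w n) has_field_derivative
           of_nat n * (ray_legendre w n - ray_legendre w (n - 1)) / w) (at w)"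
proof (induction n rule: induct_nat_012)
  case (ge2 n)
  define N where "N = (of_nat n :: complex)"
  define T where "T = ray_legendre w"
  have nz: "N + 2 \<noteq> 0" unfolding N_def by (rule of_nat_add_nonzero)
  have D1: "((\<lambda>w. ray_legendre w (Suc n)) has_field_derivative (N + 1) * (T (Suc n) - T n) / w) (at w)"
    using ge2(2) unfolding N_def T_def by (simp add: add.commute)
  have D0: "((\<lambda>w. ray_legendre w n) has_field_derivative N * (T n - T (n - 1)) / w) (at w)"
    using ge2(1) unfolding N_def T_def .
  have r: "(N + 2) * T (Suc (Suc n)) = (2 * N + 3) * T (Suc n) - (N + 1) * (1 - w\<^sup>2) * T n"
    using hom_legendre_rec[of n 1 "1 - w\<^sup>2"] by (simp only: N_def T_def mult_1_right)
  have r': "N * (1 - w\<^sup>2) * T (n - 1) = (2 * N + 1) * T n - (N + 1) * T (Suc n)"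
  proof (cases n)
    case (Suc m)
    show ?thesis
      using hom_legendre_rec[of m 1 "1 - w\<^sup>2"]
      unfolding Suc N_def T_def by (simp add: algebra_simps del: hom_legendre.simps)
  qed (simp add: N_def T_def)
  have "((\<lambda>w. ((2 * N + 3) * ray_legendre w (Suc n) - (N + 1) * ((1 - w\<^sup>2) * ray_legendre w n)) / (N + 2))
      has_field_derivative ((2 * N + 3) * ((N + 1) * (T (Suc n) - T n) / w)
        - (N + 1) * ((- 2 * w) * T n + (1 - w\<^sup>2) * (N * (T n - T (n - 1)) / w))) / (N + 2)) (at w)"
  proof -
    have W: "((\<lambda>w. 1 - w\<^sup>2) has_field_derivative - 2 * w) (at w)"
      by (auto intro!: derivative_eq_intros)
    show ?thesis
      by (rule DERIV_cong[OF DERIV_cdivide[OF DERIV_diff[OF DERIV_cmult[OF D1] DERIV_cmult[OF DERIV_mult[OF W D0]]]]])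
         (simp add: T_def mult_ac)
  qed
  also have "((2 * N + 3) * ((N + 1) * (T (Suc n) - T n) / w)
        - (N + 1) * ((- 2 * w) * T n + (1 - w\<^sup>2) * (N * (T n - T (n - 1)) / w))) / (N + 2)
      = (N + 2) * (T (Suc (Suc n)) - T (Suc n)) / w"
  proof -
    have "(2 * N + 3) * ((N + 1) * (T (Suc n) - T n))
        - (N + 1) * ((- 2 * w * w) * T n + (1 - w\<^sup>2) * (N * (T n - T (n - 1))))
      = (N + 2) * ((N + 2) * (T (Suc (Suc n)) - T (Suc n)))"
      using r r' by algebra
    moreover have "(2 * N + 3) * ((N + 1) * (T (Suc n) - T n) / w)
        - (N + 1) * ((- 2 * w) * T n + (1 - w\<^sup>2) * (N * (T n - T (n - 1)) / w))
      = ((2 * N + 3) * ((N + 1) * (T (Suc n) - T n))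
        - (N + 1) * ((- 2 * w * w) * T n + (1 - w\<^sup>2) * (N * (T n - T (n - 1))))) / w"
      using assms by (simp add: field_simps)
    ultimately show ?thesis
      using nz by simp
  qed
  also have "(\<lambda>w. ((2 * N + 3) * ray_legendre w (Suc n) - (N + 1) * ((1 - w\<^sup>2) * ray_legendre w n)) / (N + 2))
      = (\<lambda>w. ray_legendre w (Suc (Suc n)))"
    by (simp add: N_def mult.assoc)
  finally show ?case
    by (simp add: N_def T_def add.commute)
qed simp_all

text \<open>This is x / (1 + x)^2 divided by 1 - w^2: the missing power (1 - w^2)^n is consumed by
  Clausen's formula.\<close>

definition ray_ratio :: "complex \<Rightarrow> complex" where
  "ray_ratio w = 4 * w\<^sup>2 / (4 - 3 * w\<^sup>2)\<^sup>2"

text \<open>The n-th term of the series over (1 + x)^2, rewritten in w; this is the normalization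
  for which the derivative telescopes.\<close>

definition ray_term :: "complex \<Rightarrow> nat \<Rightarrow> complex" where
  "ray_term w n = of_nat (2 * n choose n) * ray_ratio w ^ n * ray_legendre w n *
     ((8 * w\<^sup>2 * (3 - 2 * w\<^sup>2) + of_nat n * (16 + 40 * w\<^sup>2 - 35 * w ^ 4)) * ray_legendre w n
       - 16 * of_nat n * (4 - 3 * w\<^sup>2) * (1 - w\<^sup>2) * ray_legendre w (n - 1)) / (4 - 3 * w\<^sup>2)\<^sup>2"

text \<open>Found by creative telescoping, as the certificate of the first-order equation \<open>ray_term_deriv\<close>.\<close>
definition ray_cert :: "complex \<Rightarrow> nat \<Rightarrow> complex" where
  "ray_cert w n = of_nat (2 * n choose n) * ray_ratio w ^ n * (of_nat n)\<^sup>2 * ray_legendre w (n - 1) *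
     (5 * ray_legendre w n - 8 * (1 - w\<^sup>2) / (4 - 3 * w\<^sup>2) * ray_legendre w (n - 1))"

lemma series_term_eq_ray_term:
  assumes w: "w\<^sup>2 \<noteq> 1" "4 - 3 * w\<^sup>2 \<noteq> 0" and x: "x = w\<^sup>2 / (4 * (1 - w\<^sup>2))"
  shows "series_term x n = (1 + x)\<^sup>2 * ray_term w n"
proof -
  define y where "y = w\<^sup>2"
  define q where "q = 4 - 3 * y"
  have nz: "1 - y \<noteq> 0" "q \<noteq> 0" using w by (auto simp: y_def q_def)
  have w4: "w ^ 4 = y\<^sup>2" by (simp add: y_def flip: power_mult)
  have x1: "1 + x = q / (4 * (1 - y))"
    using nz(1) unfolding x y_def[symmetric] q_def by (simp add: field_simps)
  have x4: "1 + 4 * x = 1 / (1 - y)"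
    using nz(1) unfolding x y_def[symmetric] by (simp add: field_simps)
  have z: "x / (1 + x)\<^sup>2 = ray_ratio w * (1 - y)"
  proof -
    have "x / (1 + x)\<^sup>2 = (y / (4 * (1 - y))) / (q / (4 * (1 - y)))\<^sup>2"
      by (simp only: x1) (simp only: x y_def)
    also have "\<dots> = 4 * y / q\<^sup>2 * (1 - y)"
      using nz by (simp add: field_simps power2_eq_square)
    finally show ?thesis by (simp add: ray_ratio_def y_def q_def)
  qed
  have al: "2 * x * (3 + 4 * x) = y * (3 - 2 * y) / (2 * (1 - y)\<^sup>2)"
    using nz(1) unfolding x y_def[symmetric] by (simp add: divide_simps) algebra
  have de: "1 + 18 * x + 21 * x\<^sup>2 = (16 + 40 * y - 35 * y\<^sup>2) / (16 * (1 - y)\<^sup>2)"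
    using nz(1) unfolding x y_def[symmetric] by (simp add: divide_simps) algebra
  let ?T = "ray_legendre w"
  have inner: "(1 - y) ^ n * inner_sum x n
     = ?T n * ((2 * x * (3 + 4 * x) + of_nat n * (1 + 18 * x + 21 * x\<^sup>2)) * ?T n
        - 4 * (1 + x) * of_nat n * ?T (n - 1))"
  proof (cases n)
    case 0
    then show ?thesis by (simp add: inner_sum_def)
  next
    case (Suc m)
    show ?thesis
      using inner_sum_hom_legendre[of 1 x "1 - y" m] x4 nz(1)
      unfolding Suc y_def by (simp add: add.commute del: hom_legendre.simps)
  qed
  have "series_term x n = of_nat (2 * n choose n) * ray_ratio w ^ n * ((1 - y) ^ n * inner_sum x n)"
    unfolding series_term_def z by (simp add: power_mult_distrib mult_ac)
  also have "(1 - y) ^ n * inner_sum x n = (1 + x)\<^sup>2 * (?T n *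
     ((8 * y * (3 - 2 * y) + of_nat n * (16 + 40 * y - 35 * y\<^sup>2)) * ?T n
       - 16 * of_nat n * q * (1 - y) * ?T (n - 1)) / q\<^sup>2)"
    unfolding inner al de x1 using nz by (simp add: divide_simps) algebra
  finally show ?thesis
    unfolding ray_term_def w4 y_def[symmetric] q_def[symmetric] by (simp add: mult_ac)
qed

lemma of_nat_Suc_times_central_binomial:
  "(of_nat n + 1) * (of_nat (2 * Suc n choose Suc n) :: complex) = 2 * (2 * of_nat n + 1) * of_nat (2 * n choose n)"
proof -
  have "of_nat (Suc n * (2 * Suc n choose Suc n)) = (of_nat (2 * (2 * n + 1) * (2 * n choose n)) :: complex)"
    by (simp only: Suc_times_central_binomial)
  then show ?thesis by (simp only: of_nat_mult of_nat_Suc of_nat_add of_nat_numeral of_nat_1 add.commute)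
qed

text \<open>Once denominators are cleared by q^3 and the common factor \<open>c * E\<close> is split
  off, the derivative formula and the recurrence reduce the claim to a polynomial identity in N, y
  and two consecutive Legendre values.\<close>

lemma ray_term_deriv:
  assumes w: "w \<noteq> 0" "4 - 3 * w\<^sup>2 \<noteq> 0"
  shows "((\<lambda>w. ray_term w n) has_field_derivative 2 * (ray_cert w (Suc n) - ray_cert w n) / w) (at w)"
proof -
  define N where "N = (of_nat n :: complex)"
  define y where "y = w\<^sup>2"
  define q where "q = 4 - 3 * y"
  define T0 T1 T2 where "T0 = ray_legendre w (n - 1)" and "T1 = ray_legendre w n" and "T2 = ray_legendre w (Suc n)"
  define c where "c = (of_nat (2 * n choose n) :: complex)"
  define E where "E = ray_ratio w ^ n"
  have q: "q \<noteq> 0" using w by (simp add: q_def y_def)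
  have T01: "hom_legendre 1 (1 - y) (n - 1) = T0" "hom_legendre 1 (1 - y) n = T1"
    by (simp_all add: T0_def T1_def y_def)
  have yw: "y = w * w" by (simp add: y_def power2_eq_square)
  have w4: "w ^ 4 = y\<^sup>2" by (simp add: y_def flip: power_mult)
  have rec: "(N + 1) * T2 = (2 * N + 1) * T1 - N * (1 - y) * T0"
  proof (cases n)
    case (Suc m)
    show ?thesis
      using hom_legendre_rec[of m 1 "1 - w\<^sup>2"]
      unfolding T0_def T1_def T2_def N_def y_def Suc by (simp add: algebra_simps del: hom_legendre.simps)
  qed (simp add: T0_def T1_def T2_def N_def)
  have dT1: "((\<lambda>w. ray_legendre w n) has_field_derivative N * (T1 - T0) / w) (at w)"
    using ray_legendre_deriv[OF w(1), of n] unfolding N_def T0_def T1_def .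
  define d0 where "d0 = of_nat (n - 1) * (T0 - ray_legendre w (n - 1 - 1)) / w"
  have dT0: "((\<lambda>w. ray_legendre w (n - 1)) has_field_derivative d0) (at w)"
    using ray_legendre_deriv[OF w(1), of "n - 1"] unfolding d0_def T0_def .
  \<comment> \<open>The derivative of \<open>T0\<close> brings in the value at n - 2. The factor 1 -
    y lets the recurrence eliminate it without a division, and the factor N makes the truncated
    indices at n = 0 harmless.\<close>
  have d0: "N * ((1 - y) * (w * d0)) = N * ((N - 1) * (1 - y) * T0 - (2 * N - 1) * T0 + N * T1)"
  proof -
    consider "n = 0" | "n = 1" | m where "n = Suc (Suc m)"
      by (metis One_nat_def not0_implies_Suc)
    then show ?thesis
    proof cases
      case 3
      have "(1 - y) * (w * d0) = (1 - y) * ((N - 1) * (T0 - ray_legendre w m))"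
        unfolding d0_def 3 N_def using w(1) by (simp del: hom_legendre.simps)
      also have "\<dots> = (N - 1) * (1 - y) * T0 - (2 * N - 1) * T0 + N * T1"
        using hom_legendre_rec[of m 1 "1 - w\<^sup>2"]
        unfolding T0_def T1_def N_def y_def 3 by (simp add: algebra_simps del: hom_legendre.simps)
      finally show ?thesis by simp
    qed (auto simp: N_def d0_def T0_def T1_def)
  qed
  have dE: "((\<lambda>w. ray_ratio w ^ n) has_field_derivative 2 * N * E * (4 + 3 * y) / (q * w)) (at w)"
  proof (cases n)
    case (Suc m)
    have "(ray_ratio has_field_derivative 2 * ray_ratio w * (4 + 3 * y) / (q * w)) (at w)"
    proof -
      have "((\<lambda>w. 4 * w\<^sup>2 / (4 - 3 * w\<^sup>2)\<^sup>2) has_field_derivative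
        ((8 * w) * (4 - 3 * w\<^sup>2)\<^sup>2 - 4 * w\<^sup>2 * (2 * (4 - 3 * w\<^sup>2) * (- 6 * w))) / ((4 - 3 * w\<^sup>2)\<^sup>2 * (4 - 3 * w\<^sup>2)\<^sup>2)) (at w)"
        using w(2) by (auto intro!: derivative_eq_intros)
      also have "((8 * w) * (4 - 3 * w\<^sup>2)\<^sup>2 - 4 * w\<^sup>2 * (2 * (4 - 3 * w\<^sup>2) * (- 6 * w))) / ((4 - 3 * w\<^sup>2)\<^sup>2 * (4 - 3 * w\<^sup>2)\<^sup>2)
        = 2 * (4 * w\<^sup>2 / (4 - 3 * w\<^sup>2)\<^sup>2) * (4 + 3 * y) / (q * w)"
      proof -
        have "(8 * w * q\<^sup>2 - 4 * y * (2 * q * (- 6 * w))) / (q\<^sup>2 * q\<^sup>2) = 2 * (4 * y / q\<^sup>2) * (4 + 3 * y) / (q * w)"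
          using q w(1) by (simp add: divide_simps) (insert yw q_def, algebra)
        then show ?thesis by (simp add: q_def y_def)
      qed
      finally show ?thesis by (simp add: ray_ratio_def[abs_def])
    qed
    then show ?thesis
      unfolding Suc E_def N_def
      by (rule DERIV_power_Suc[THEN DERIV_cong]) (simp add: field_simps)
  qed (simp add: N_def)
  define U where "U = (8 * y * (3 - 2 * y) + N * (16 + 40 * y - 35 * y\<^sup>2)) * T1 - 16 * N * q * (1 - y) * T0"
  define dU where "dU = (8 * (2 * w) * (3 - 2 * y) + 8 * y * (- 4 * w) + N * (80 * w - 140 * w * y)) * T1
      + (8 * y * (3 - 2 * y) + N * (16 + 40 * y - 35 * y\<^sup>2)) * (N * (T1 - T0) / w)
      - (16 * N * ((- 6 * w) * (1 - y) + q * (- 2 * w)) * T0 + 16 * N * q * (1 - y) * d0)"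
  have dU: "((\<lambda>w. (8 * w\<^sup>2 * (3 - 2 * w\<^sup>2) + N * (16 + 40 * w\<^sup>2 - 35 * w ^ 4)) * ray_legendre w n
       - 16 * N * (4 - 3 * w\<^sup>2) * (1 - w\<^sup>2) * ray_legendre w (n - 1)) has_field_derivative dU) (at w)"
  proof -
    have 1: "((\<lambda>w. 8 * w\<^sup>2 * (3 - 2 * w\<^sup>2) + N * (16 + 40 * w\<^sup>2 - 35 * w ^ 4)) has_field_derivative
        8 * (2 * w) * (3 - 2 * y) + 8 * y * (- 4 * w) + N * (80 * w - 140 * w * y)) (at w)"
      by (auto intro!: derivative_eq_intros simp: yw algebra_simps power2_eq_square power3_eq_cube)
    have 2: "((\<lambda>w. 16 * N * (4 - 3 * w\<^sup>2) * (1 - w\<^sup>2)) has_field_derivative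
        16 * N * ((- 6 * w) * (1 - y) + q * (- 2 * w))) (at w)"
      by (auto intro!: derivative_eq_intros simp: yw q_def algebra_simps power2_eq_square power3_eq_cube)
    show ?thesis
      by (rule DERIV_cong[OF DERIV_diff[OF DERIV_mult[OF 1 dT1] DERIV_mult[OF 2 dT0]]])
         (simp only: dU_def y_def[symmetric] w4 q_def[symmetric] T01, simp add: algebra_simps)
  qed
  have dq: "((\<lambda>w. (4 - 3 * w\<^sup>2)\<^sup>2) has_field_derivative 2 * q * (- 6 * w)) (at w)"
    by (auto intro!: derivative_eq_intros simp: q_def y_def)
  define D where "D = (((c * (2 * N * E * (4 + 3 * y) / (q * w)) * T1 + N * (T1 - T0) / w * (c * E)) * U
      + dU * (c * E * T1)) * q\<^sup>2 - c * E * T1 * U * (2 * q * (- 6 * w))) / (q\<^sup>2 * q\<^sup>2)"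
  have q2: "(4 - 3 * w\<^sup>2)\<^sup>2 \<noteq> 0" using w(2) by simp
  have D: "((\<lambda>w. ray_term w n) has_field_derivative D) (at w)"
    unfolding ray_term_def c_def[symmetric] N_def[symmetric]
    by (rule DERIV_cong[OF DERIV_divide[OF DERIV_mult[OF DERIV_mult[OF DERIV_cmult[OF dE] dT1] dU] dq q2]])
       (simp only: D_def U_def y_def[symmetric] w4 q_def[symmetric] T01 E_def[symmetric])
  define P where "P = 2 * N * (4 + 3 * y) * T1 * U + q * N * (T1 - T0) * U + q * T1 * (w * dU) + 12 * y * T1 * U"
  have DP: "w * D * q ^ 3 = c * E * P"
    unfolding D_def P_def using q w(1) by (simp add: divide_simps) (simp add: yw algebra_simps power2_eq_square power3_eq_cube power4_eq_xxxx)
  \<comment> \<open>\<open>P\<close> and \<open>Q\<close> are the two sides of the telescoped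
    equation, times q^3 and without \<open>c * E\<close>.\<close>
  define Q where "Q = 2 * (8 * y * (2 * N + 1) * T1 * (5 * q * ((N + 1) * T2) - 8 * (N + 1) * (1 - y) * T1)
      - N\<^sup>2 * T0 * (5 * q * T1 - 8 * (1 - y) * T0) * q\<^sup>2)"
  have "P = Q"
  proof -
    have wdU: "w * dU = (8 * (2 * y) * (3 - 2 * y) + 8 * y * (- 4 * y) + N * (80 * y - 140 * y * y)) * T1
      + (8 * y * (3 - 2 * y) + N * (16 + 40 * y - 35 * y\<^sup>2)) * (N * (T1 - T0))
      - (16 * N * ((- 6 * y) * (1 - y) + q * (- 2 * y)) * T0 + 16 * q * (N * ((N - 1) * (1 - y) * T0 - (2 * N - 1) * T0 + N * T1)))"
    proof -
      define e where "e = N * (T1 - T0) / w"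
      have "w * e = N * (T1 - T0)" using w(1) by (simp add: e_def)
      then show ?thesis
        unfolding d0[symmetric] dU_def e_def[symmetric] using yw by algebra
    qed
    show ?thesis
      unfolding P_def Q_def wdU rec U_def q_def by algebra
  qed
  have C1: "(N + 1) * of_nat (2 * Suc n choose Suc n) = 2 * (2 * N + 1) * c"
    unfolding N_def c_def by (rule of_nat_Suc_times_central_binomial)
  have b1: "ray_cert w (Suc n) * q ^ 3 = c * E * (8 * y * (2 * N + 1) * T1 * (5 * q * ((N + 1) * T2) - 8 * (N + 1) * (1 - y) * T1))"
  proof -
    have "ray_cert w (Suc n) = ((N + 1) * of_nat (2 * Suc n choose Suc n)) * (4 * y / q\<^sup>2 * E) * (N + 1) * T1 * (5 * T2 - 8 * (1 - y) / q * T1)"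
      unfolding ray_cert_def E_def T1_def T2_def y_def q_def N_def
      by (simp add: ray_ratio_def power2_eq_square mult_ac add.commute del: hom_legendre.simps binomial_Suc_Suc)
    also have "\<dots> * q ^ 3 = c * E * (8 * y * (2 * N + 1) * T1 * (5 * q * ((N + 1) * T2) - 8 * (N + 1) * (1 - y) * T1))"
      unfolding C1 using q by (simp add: field_simps power2_eq_square power3_eq_cube)
    finally show ?thesis .
  qed
  have b0: "ray_cert w n * q ^ 3 = c * E * (N\<^sup>2 * T0 * (5 * q * T1 - 8 * (1 - y) * T0) * q\<^sup>2)"
    unfolding ray_cert_def E_def[symmetric] y_def[symmetric] q_def[symmetric] N_def[symmetric] c_def[symmetric] T01
    using q by (simp add: field_simps power2_eq_square power3_eq_cube)
  have "(2 * (ray_cert w (Suc n) - ray_cert w n)) * q ^ 3 = 2 * (ray_cert w (Suc n) * q ^ 3 - ray_cert w n * q ^ 3)"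
    by (simp add: algebra_simps)
  also have "\<dots> = c * E * Q"
    unfolding b0 b1 Q_def by (simp add: algebra_simps)
  also have "\<dots> = w * D * q ^ 3" using DP \<open>P = Q\<close> by simp
  finally have "w * D = 2 * (ray_cert w (Suc n) - ray_cert w n)"
    using q by simp
  then have "D = 2 * (ray_cert w (Suc n) - ray_cert w n) / w"
    using w(1) by (simp add: field_simps)
  with D show ?thesis by simp
qed

subsection \<open>Integration along the segment\<close>

text \<open>The factor 2 n + 1 closes the induction, since (2 n + 3)(2 n + 1) \<le> 4 (n + 1)^2. It
  yields the gain 1 / sqrt n without which the final bound would stay bounded but not tend to
  0.\<close>

lemma central_binomial_sq_le: "(2 * n + 1) * ((2 * n) choose n)\<^sup>2 \<le> 16 ^ n"
proof (induction n)
  case (Suc n)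
  define C where "C = (2 * n) choose n"
  have "(Suc n)\<^sup>2 * ((2 * Suc n + 1) * C'\<^sup>2) = (2 * n + 3) * (Suc n * C')\<^sup>2" for C'
    by (simp add: power2_eq_square algebra_simps)
  then have "(Suc n)\<^sup>2 * ((2 * Suc n + 1) * ((2 * Suc n) choose Suc n)\<^sup>2)
      = (2 * n + 3) * (Suc n * ((2 * Suc n) choose Suc n))\<^sup>2" .
  also have "\<dots> = 4 * ((2 * n + 3) * (2 * n + 1)) * ((2 * n + 1) * C\<^sup>2)"
    unfolding Suc_times_central_binomial C_def by (simp add: power2_eq_square algebra_simps)
  also have "\<dots> \<le> 4 * (4 * (Suc n)\<^sup>2) * 16 ^ n"
  proof (rule mult_le_mono)
    show "4 * ((2 * n + 3) * (2 * n + 1)) \<le> 4 * (4 * (Suc n)\<^sup>2)"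
      by (simp add: power2_eq_square algebra_simps)
    show "(2 * n + 1) * C\<^sup>2 \<le> 16 ^ n" using Suc unfolding C_def .
  qed
  also have "\<dots> = (Suc n)\<^sup>2 * 16 ^ Suc n" by simp
  finally show ?case by (simp only: mult_le_cancel1) simp
qed simp

lemma central_binomial_le:
  assumes "n > 0"
  shows "real ((2 * n) choose n) \<le> 4 ^ n / sqrt n"
proof -
  have "real ((2 * n + 1) * ((2 * n) choose n)\<^sup>2) \<le> real (16 ^ n)"
    unfolding of_nat_le_iff by (rule central_binomial_sq_le)
  moreover have "real n * (real ((2 * n) choose n))\<^sup>2 \<le> real ((2 * n + 1) * ((2 * n) choose n)\<^sup>2)"
    unfolding of_nat_mult of_nat_power by (intro mult_right_mono) auto
  moreover have "(sqrt n * real ((2 * n) choose n))\<^sup>2 = real n * (real ((2 * n) choose n))\<^sup>2"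
    by (simp add: power_mult_distrib)
  moreover have "((4::real) ^ n)\<^sup>2 = real (16 ^ n)"
    by (simp add: power2_eq_square flip: power_mult_distrib)
  ultimately have "(sqrt n * real ((2 * n) choose n))\<^sup>2 \<le> (4 ^ n)\<^sup>2" by linarith
  then have "sqrt n * real ((2 * n) choose n) \<le> 4 ^ n"
    by (rule power2_le_imp_le) simp
  then show ?thesis using assms by (simp add: field_simps)
qed

text \<open>In terms of r = |w|^2, Re w and Re (w^2), the gap at \<open>s * w\<close> minus 16 (1 -
  s^2) is s^2 times the gap at w plus two nonnegative terms, one of them through Re w \<ge> 0. The
  constant 16 is the gap at s = 0.\<close>

lemma ray_region:
  fixes w :: complex and s :: real
  assumes w: "Re w \<ge> 0" "(norm (4 * w * (1 + w)))\<^sup>2 \<le> (norm (4 - 3 * w\<^sup>2))\<^sup>2" and s: "0 \<le> s" "s \<le> 1"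
  shows "(norm (4 * (of_real s * w) * (1 + of_real s * w)))\<^sup>2 + 16 * (1 - s\<^sup>2)
           \<le> (norm (4 - 3 * (of_real s * w)\<^sup>2))\<^sup>2"
proof -
  obtain a b where ab: "w = Complex a b" by (cases w)
  define r where "r = a\<^sup>2 + b\<^sup>2"
  define d where "d = a\<^sup>2 - b\<^sup>2"
  have N: "(norm (4 * (of_real t * w) * (1 + of_real t * w)))\<^sup>2 = 16 * t\<^sup>2 * r * (1 + 2 * t * a + t\<^sup>2 * r)" for t :: real
    unfolding norm_mult power_mult_distrib unfolding cmod_power2 ab r_def
    by (simp add: power2_eq_square algebra_simps)
  have D: "(norm (4 - 3 * (of_real t * w)\<^sup>2))\<^sup>2 = 16 + 9 * t ^ 4 * r\<^sup>2 - 24 * t\<^sup>2 * d" for t :: real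
    unfolding cmod_power2 ab r_def d_def
    by (simp add: power2_eq_square power4_eq_xxxx algebra_simps)
  have a: "a \<ge> 0" using w(1) ab by simp
  have r: "r \<ge> 0" by (simp add: r_def)
  have "16 * r * (1 + 2 * a + r) \<le> 16 + 9 * r\<^sup>2 - 24 * d"
  proof -
    have "(norm (4 * w * (1 + w)))\<^sup>2 = 16 * r * (1 + 2 * a + r)" "(norm (4 - 3 * w\<^sup>2))\<^sup>2 = 16 + 9 * r\<^sup>2 - 24 * d"
      using N[of 1] D[of 1] by simp_all
    then show ?thesis using w(2) by (simp only:)
  qed
  then have h: "s\<^sup>2 * (16 * r * (1 + 2 * a + r)) \<le> s\<^sup>2 * (16 + 9 * r\<^sup>2 - 24 * d)"
    by (intro mult_left_mono) auto
  have "16 * s\<^sup>2 * (2 * r * a * (1 - s)) \<ge> 0" "(1 - s\<^sup>2) * (7 * s\<^sup>2 * r\<^sup>2) \<ge> 0"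
    using a r s by (auto intro!: mult_nonneg_nonneg simp: power_le_one)
  moreover have "16 + 9 * s ^ 4 * r\<^sup>2 - 24 * s\<^sup>2 * d - (16 * s\<^sup>2 * r * (1 + 2 * s * a + s\<^sup>2 * r) + 16 * (1 - s\<^sup>2))
      = (s\<^sup>2 * (16 + 9 * r\<^sup>2 - 24 * d) - s\<^sup>2 * (16 * r * (1 + 2 * a + r)))
        + 16 * s\<^sup>2 * (2 * r * a * (1 - s)) + (1 - s\<^sup>2) * (7 * s\<^sup>2 * r\<^sup>2)"
    by (simp add: power2_eq_square power4_eq_xxxx algebra_simps)
  ultimately show ?thesis
    unfolding N D using h by linarith
qed

text \<open>The differential equation divides by w, so the starting point s = 0 is reached only by
  continuity.\<close>

lemma ray_term_continuous:
  assumes "\<And>s. s \<in> {0..1} \<Longrightarrow> 4 - 3 * (of_real s * w)\<^sup>2 \<noteq> (0 :: complex)"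
  shows "continuous_on {0..1} (\<lambda>s::real. ray_term (of_real s * w) n)"
proof -
  have T: "continuous_on {0..1} (\<lambda>s::real. ray_legendre (of_real s * w) m)" for m
    by (induction m rule: induct_nat_012) (auto intro!: continuous_intros of_nat_add_nonzero)
  show ?thesis
    unfolding ray_term_def ray_ratio_def
    by (intro continuous_intros T) (use assms in auto)
qed

lemma ray_term_sums:
  fixes w :: complex
  assumes w: "Re w \<ge> 0" "w \<noteq> 0" and reg: "norm (4 * w * (1 + w)) \<le> norm (4 - 3 * w\<^sup>2)"
  shows "(\<lambda>n. ray_term w n) sums 0"
proof -
  define W where "W = norm w"
  have W: "W > 0" using w(2) by (simp add: W_def)
  have reg2: "(norm (4 * w * (1 + w)))\<^sup>2 \<le> (norm (4 - 3 * w\<^sup>2))\<^sup>2"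
    using reg by (intro power_mono) auto
  define D where "D = (\<lambda>s::real. (norm (4 - 3 * (of_real s * w)\<^sup>2))\<^sup>2)"
  define M where "M = (\<lambda>s::real. norm (1 + of_real s * w))"
  have M1: "1 \<le> M s" if "0 \<le> s" for s
  proof -
    have "1 \<le> Re (1 + of_real s * w)" using that w(1) by simp
    then show ?thesis unfolding M_def using complex_Re_le_cmod order_trans by blast
  qed
  have M2: "M s \<le> 1 + W" if "0 \<le> s" "s \<le> 1" for s
  proof -
    have "M s \<le> 1 + s * W"
      unfolding M_def W_def using norm_triangle_ineq[of 1 "of_real s * w"] that by (simp add: norm_mult)
    also have "s * W \<le> 1 * W" using that W by (intro mult_right_mono) auto
    finally show ?thesis by simp
  qed
  have region: "16 * s\<^sup>2 * W\<^sup>2 * (M s)\<^sup>2 + 16 * (1 - s\<^sup>2) \<le> D s" if "0 \<le> s" "s \<le> 1" for s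
    using ray_region[OF w(1) reg2 that] that
    unfolding D_def M_def W_def by (simp add: norm_mult power_mult_distrib)
  \<comment> \<open>For s^2 \<le> 1/2 the summand 16 (1 - s^2) of \<open>region\<close> is at least
    8; otherwise the other summand is at least 8 W^2, as M s \<ge> 1. So the denominator stays
    uniformly away from 0.\<close>
  define d0 where "d0 = min 8 (8 * W\<^sup>2)"
  have d0: "d0 > 0" using W by (simp add: d0_def)
  have D_ge: "d0 \<le> D s" if s: "0 \<le> s" "s \<le> 1" for s
  proof (cases "s\<^sup>2 \<le> 1 / 2")
    case True
    have "0 + 8 \<le> 16 * s\<^sup>2 * W\<^sup>2 * (M s)\<^sup>2 + 16 * (1 - s\<^sup>2)"
      using True by (intro add_mono) auto
    then have "8 \<le> D s" using region[OF s] by linarith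
    then show ?thesis by (simp add: d0_def)
  next
    case False
    have "8 * W\<^sup>2 * 1 \<le> (16 * s\<^sup>2) * W\<^sup>2 * (M s)\<^sup>2"
      using False M1[OF s(1)] by (intro mult_mono one_le_power) auto
    moreover have "0 \<le> 16 * (1 - s\<^sup>2)" using s by (simp add: power_le_one)
    ultimately have "8 * W\<^sup>2 * 1 + 0 \<le> 16 * s\<^sup>2 * W\<^sup>2 * (M s)\<^sup>2 + 16 * (1 - s\<^sup>2)"
      by (rule add_mono)
    also note region[OF s]
    finally have "8 * W\<^sup>2 \<le> D s" by simp
    then show ?thesis by (simp add: d0_def)
  qed
  have nz: "4 - 3 * (of_real s * w)\<^sup>2 \<noteq> 0" if "0 \<le> s" "s \<le> 1" for s
    using D_ge[OF that] d0 by (auto simp: D_def)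
  define D1 where "D1 = (4 + 3 * W\<^sup>2)\<^sup>2"
  have D_le: "D s \<le> D1" if s: "0 \<le> s" "s \<le> 1" for s
  proof -
    have "norm (4 - 3 * (of_real s * w)\<^sup>2) \<le> 4 + 3 * (s * W)\<^sup>2"
      using norm_triangle_ineq4[of 4 "3 * (of_real s * w)\<^sup>2"] s by (simp add: norm_mult norm_power W_def)
    also have "(s * W)\<^sup>2 \<le> W\<^sup>2"
      using s W by (intro power_mono mult_left_le_one_le) auto
    finally show ?thesis unfolding D_def D1_def by (intro power_mono) auto
  qed
  have D1: "D1 > 0" using D_ge[of 0] D_le[of 0] d0 by simp
  \<comment> \<open>By \<open>region\<close> the squared ratio \<open>\<rho> s\<close> is at most 1
    - 16 (1 - s^2) / D s, and D s \<le> \<open>D1\<close>.\<close>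
  define \<kappa> where "\<kappa> = 16 / D1"
  have kap: "\<kappa> > 0" using D1 by (simp add: \<kappa>_def)
  define \<rho> where "\<rho> = (\<lambda>s. 16 * s\<^sup>2 * W\<^sup>2 * (M s)\<^sup>2 / D s)"
  define K where "K = 16 * W\<^sup>2 * (1 + W)\<^sup>2 / d0"
  have K0: "K \<ge> 0" using d0 by (simp add: K_def)
  have rho0: "0 \<le> \<rho> s" if "0 \<le> s" "s \<le> 1" for s
    using D_ge[OF that] d0 by (simp add: \<rho>_def)
  have rho_exp: "\<rho> s \<le> exp (- \<kappa> * (1 - s\<^sup>2))" if s: "0 \<le> s" "s \<le> 1" for s
  proof -
    have Dpos: "D s > 0" using D_ge[OF s] d0 by linarith
    have s2: "s\<^sup>2 \<le> 1" using s by (simp add: power_le_one)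
    have "\<rho> s \<le> (D s - 16 * (1 - s\<^sup>2)) / D s"
      unfolding \<rho>_def using region[OF s] Dpos by (intro divide_right_mono) auto
    also have "\<dots> = 1 - 16 * (1 - s\<^sup>2) / D s" using Dpos by (simp add: field_simps)
    also have "16 * (1 - s\<^sup>2) / D1 \<le> 16 * (1 - s\<^sup>2) / D s"
      using D_le[OF s] Dpos s2 D1 by (intro divide_left_mono) auto
    then have "1 - 16 * (1 - s\<^sup>2) / D s \<le> 1 + - \<kappa> * (1 - s\<^sup>2)" by (simp add: \<kappa>_def)
    also have "\<dots> \<le> exp (- \<kappa> * (1 - s\<^sup>2))" by (rule exp_ge_add_one_self)
    finally show ?thesis .
  qed
  have rho_sq: "\<rho> s \<le> K * s\<^sup>2" if s: "0 \<le> s" "s \<le> 1" for s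
  proof -
    have "\<rho> s \<le> 16 * s\<^sup>2 * W\<^sup>2 * (1 + W)\<^sup>2 / d0"
      unfolding \<rho>_def using D_ge[OF s] d0 M2[OF s] M1[OF s(1)] W
      by (intro frac_le mult_left_mono power_mono) auto
    then show ?thesis by (simp add: K_def mult_ac)
  qed
  \<comment> \<open>The factor 2 lets one constant serve the indices n and n - 1, since sqrt n \<le>
    2 sqrt (n - 1) for n \<ge> 2.\<close>
  define c where "c = 2 * (pi * (1 + W) / W)"
  have c0: "c > 0" using W by (simp add: c_def add_pos_pos)
  have T_le: "norm (ray_legendre (of_real s * w) m) \<le> M s ^ n * (c / (s * sqrt n))"
    if s: "0 < s" "s \<le> 1" and m: "m = n \<or> m = n - 1" and n: "n \<ge> 2" for s m n
  proof -
    have m0: "m > 0" "m \<le> n" "n \<le> 2 * m" using m n by auto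
    have "norm (ray_legendre (of_real s * w) m)
        \<le> norm (1 + of_real s * w) ^ m * (pi * norm (1 + of_real s * w) / (norm (of_real s * w) * sqrt m))"
      using s w m0(1) by (intro hom_legendre_norm_le) auto
    also have "\<dots> = M s ^ m * (pi * M s / (s * W * sqrt m))"
      using s by (simp add: M_def W_def norm_mult)
    also have "\<dots> \<le> M s ^ n * (c / (s * sqrt n))"
    proof (rule mult_mono)
      show "M s ^ m \<le> M s ^ n" using M1[of s] s m0(2) by (intro power_increasing) auto
      have "sqrt n \<le> sqrt (4 * real m)" using m0(3) by (intro real_sqrt_le_mono) linarith
      then have sq: "sqrt n \<le> 2 * sqrt m" by (simp add: real_sqrt_mult)
      have "pi * M s / (s * W * sqrt m) = 2 * (pi * M s) / (s * W * (2 * sqrt m))" by simp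
      also have "\<dots> \<le> 2 * (pi * (1 + W)) / (s * W * sqrt n)"
        using sq s W M2[of s] M1[of s] n by (intro frac_le mult_left_mono mult_pos_pos) auto
      also have "\<dots> = c / (s * sqrt n)" by (simp add: c_def field_simps)
      finally show "pi * M s / (s * W * sqrt m) \<le> c / (s * sqrt n)" .
    qed (use M1[of s] s W in auto)
    finally show ?thesis .
  qed
  define G where "G = 5 + 8 * (1 + W\<^sup>2) / sqrt d0"
  have G0: "G \<ge> 0" using d0 by (simp add: G_def)
  define Q where "Q = 2 * G * c\<^sup>2 * K\<^sup>2"
  have Q0: "Q \<ge> 0" using G0 by (simp add: Q_def)
  \<comment> \<open>Powers of n: n^2 from the certificate, n^(-1/2) from the central binomial, 1/n
    from two Legendre factors, together sqrt n. Powers of s: s^(-2) from the Legendre factors and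
    s^(-1) from the division. Two of the n factors \<open>\<rho> s\<close> are spent, through \<rho>
    s \<le> K s^2, to turn s^(-3) into s; the other n - 2 decay exponentially.\<close>
  have cert_le: "norm (2 * ray_cert (of_real s * w) n / of_real s)
      \<le> Q * sqrt n * s * exp (- \<kappa> * (1 - s\<^sup>2)) ^ (n - 2)"
    if s: "0 < s" "s \<le> 1" and n: "n \<ge> 2" for s n
  proof -
    have s': "0 \<le> s" "s \<le> 1" using s by auto
    let ?v = "of_real s * w"
    define L where "L = M s ^ n * (c / (s * sqrt n))"
    have L0: "L \<ge> 0" using M1[OF s'(1)] c0 s by (simp add: L_def)
    have Dpos: "D s > 0" using D_ge[OF s'] d0 by linarith
    have ratio: "norm (ray_ratio ?v) = 4 * (s * W)\<^sup>2 / D s"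
      unfolding ray_ratio_def D_def W_def using s by (simp add: norm_divide norm_mult norm_power)
    have frac: "norm (8 * (1 - ?v\<^sup>2) / (4 - 3 * ?v\<^sup>2)) \<le> 8 * (1 + W\<^sup>2) / sqrt d0"
    proof -
      have "norm (1 - ?v\<^sup>2) \<le> 1 + (s * W)\<^sup>2"
        using norm_triangle_ineq4[of 1 "?v\<^sup>2"] s by (simp add: norm_mult norm_power W_def)
      also have "(s * W)\<^sup>2 \<le> W\<^sup>2"
        using s W by (intro power_mono mult_left_le_one_le) auto
      finally have "norm (1 - ?v\<^sup>2) \<le> 1 + W\<^sup>2" by simp
      moreover have "sqrt d0 \<le> norm (4 - 3 * ?v\<^sup>2)"
        using D_ge[OF s'] unfolding D_def by (intro real_le_lsqrt) auto
      ultimately show ?thesis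
        unfolding norm_divide norm_mult using d0 by (intro frac_le mult_mono) auto
    qed
    have last: "norm (5 * ray_legendre ?v n - 8 * (1 - ?v\<^sup>2) / (4 - 3 * ?v\<^sup>2) * ray_legendre ?v (n - 1)) \<le> G * L"
    proof -
      have "norm (5 * ray_legendre ?v n - 8 * (1 - ?v\<^sup>2) / (4 - 3 * ?v\<^sup>2) * ray_legendre ?v (n - 1))
         \<le> norm (5 * ray_legendre ?v n) + norm (8 * (1 - ?v\<^sup>2) / (4 - 3 * ?v\<^sup>2) * ray_legendre ?v (n - 1))"
        by (rule norm_triangle_ineq4)
      also have "norm (5 * ray_legendre ?v n) \<le> 5 * L"
        unfolding norm_mult L_def using T_le[OF s _ n, of n] by simp
      also have "norm (8 * (1 - ?v\<^sup>2) / (4 - 3 * ?v\<^sup>2) * ray_legendre ?v (n - 1)) \<le> 8 * (1 + W\<^sup>2) / sqrt d0 * L"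
        unfolding norm_mult[of "8 * (1 - ?v\<^sup>2) / (4 - 3 * ?v\<^sup>2)"] L_def
        using frac T_le[OF s _ n, of "n - 1"] d0 by (intro mult_mono) auto
      finally show ?thesis by (simp add: G_def algebra_simps)
    qed
    have "norm (ray_cert ?v n) = real (2 * n choose n) * norm (ray_ratio ?v) ^ n * (real n)\<^sup>2 * norm (ray_legendre ?v (n - 1))
       * norm (5 * ray_legendre ?v n - 8 * (1 - ?v\<^sup>2) / (4 - 3 * ?v\<^sup>2) * ray_legendre ?v (n - 1))"
      unfolding ray_cert_def by (simp only: norm_mult norm_power norm_of_nat)
    also have "\<dots> \<le> (4 ^ n / sqrt n) * (4 * (s * W)\<^sup>2 / D s) ^ n * (real n)\<^sup>2 * L * (G * L)"
    proof -
      have "norm (ray_legendre ?v (n - 1)) \<le> L"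
        unfolding L_def by (rule T_le[OF s _ n]) simp
      moreover have "real (2 * n choose n) \<le> 4 ^ n / sqrt n"
        using n by (intro central_binomial_le) simp
      ultimately show ?thesis
        unfolding ratio using last L0 G0 Dpos
        by (intro mult_mono mult_nonneg_nonneg) auto
    qed
    also have "\<dots> = ((real n)\<^sup>2 / (sqrt n * (sqrt n * sqrt n))) * (4 ^ n * (4 * (s * W)\<^sup>2 / D s) ^ n * (M s ^ n * M s ^ n)) * (G * c\<^sup>2 / s\<^sup>2)"
    proof -
      have "F / r * X * m * (Y * (c / (s * r))) * (G * (Y * (c / (s * r))))
          = (m / (r * (r * r))) * (F * X * (Y * Y)) * (G * c\<^sup>2 / s\<^sup>2)"
        if "r \<noteq> 0" for F X m Y r :: real
        using that s by (simp add: field_simps power2_eq_square)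
      then show ?thesis unfolding L_def using n by simp
    qed
    also have "4 ^ n * (4 * (s * W)\<^sup>2 / D s) ^ n * (M s ^ n * M s ^ n) = \<rho> s ^ n"
      unfolding \<rho>_def power_mult_distrib[symmetric] by (simp add: power2_eq_square mult_ac)
    also have "(real n)\<^sup>2 / (sqrt n * (sqrt n * sqrt n)) = sqrt n"
    proof -
      have "sqrt n * sqrt n = real n" "sqrt n > 0" using n by auto
      then show ?thesis by (simp add: power2_eq_square) (metis real_div_sqrt of_nat_0_le_iff)
    qed
    also have "\<rho> s ^ n = (\<rho> s)\<^sup>2 * \<rho> s ^ (n - 2)"
      using n by (metis le_add_diff_inverse power_add)
    also have "sqrt n * ((\<rho> s)\<^sup>2 * \<rho> s ^ (n - 2)) * (G * c\<^sup>2 / s\<^sup>2)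
       \<le> sqrt n * ((K * s\<^sup>2)\<^sup>2 * exp (- \<kappa> * (1 - s\<^sup>2)) ^ (n - 2)) * (G * c\<^sup>2 / s\<^sup>2)"
      using rho_sq[OF s'] rho_exp[OF s'] rho0[OF s'] G0
      by (intro mult_right_mono mult_left_mono mult_mono power_mono) auto
    finally have "norm (ray_cert ?v n) \<le> sqrt n * ((K * s\<^sup>2)\<^sup>2 * exp (- \<kappa> * (1 - s\<^sup>2)) ^ (n - 2)) * (G * c\<^sup>2 / s\<^sup>2)" .
    note cert = this
    have "norm (2 * ray_cert ?v n / of_real s) = 2 * norm (ray_cert ?v n) / s"
      using s by (simp add: norm_divide norm_mult)
    also have "\<dots> \<le> 2 * (sqrt n * ((K * s\<^sup>2)\<^sup>2 * exp (- \<kappa> * (1 - s\<^sup>2)) ^ (n - 2)) * (G * c\<^sup>2 / s\<^sup>2)) / s"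
      using s cert by (intro divide_right_mono mult_left_mono) auto
    also have "\<dots> = Q * sqrt n * s * exp (- \<kappa> * (1 - s\<^sup>2)) ^ (n - 2)"
      using s by (simp add: Q_def power2_eq_square field_simps)
    finally show ?thesis .
  qed
  define S where "S = (\<lambda>n (s::real). \<Sum>k<n. ray_term (of_real s * w) k)"
  have S_bound: "norm (S n 1) \<le> Q * sqrt n / (2 * \<kappa> * (real n - 2))" if n: "n \<ge> 3" for n
  proof -
    \<comment> \<open>A primitive of the bound in \<open>cert_le\<close>; the surviving factor s
      makes it elementary. The mean value inequality then takes the place of an integral.\<close>
    define \<phi> where "\<phi> = (\<lambda>s. Q * sqrt n / (2 * \<kappa> * (real n - 2)) * exp (- \<kappa> * (1 - s\<^sup>2) * (real n - 2)))"
    have "norm (S n 1 - S n 0) \<le> \<phi> 1 - \<phi> 0"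
    proof (rule differentiable_bound_general)
      show "continuous_on {0..1} (S n)"
        unfolding S_def by (intro continuous_on_sum ray_term_continuous) (use nz in auto)
      show "continuous_on {0..1} \<phi>"
        unfolding \<phi>_def by (intro continuous_intros)
      fix s :: real assume s: "0 < s" "s < 1"
      let ?v = "of_real s * w"
      have v: "?v \<noteq> 0" "4 - 3 * ?v\<^sup>2 \<noteq> 0" using s w(2) nz[of s] by auto
      have "((\<lambda>v. \<Sum>k<n. ray_term v k) has_field_derivative
          (\<Sum>k<n. 2 * (ray_cert ?v (Suc k) - ray_cert ?v k) / ?v)) (at ?v)"
        by (intro DERIV_sum ray_term_deriv v)
      also have "(\<Sum>k<n. 2 * (ray_cert ?v (Suc k) - ray_cert ?v k) / ?v)
          = 2 * (\<Sum>k<n. ray_cert ?v (Suc k) - ray_cert ?v k) / ?v"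
        by (simp only: sum_divide_distrib sum_distrib_left)
      \<comment> \<open>The lower end of the telescope vanishes because the certificate carries the
        factor n^2.\<close>
      also have "(\<Sum>k<n. ray_cert ?v (Suc k) - ray_cert ?v k) = ray_cert ?v n"
        by (subst sum_lessThan_telescope) (simp add: ray_cert_def)
      finally have 1: "((\<lambda>v. \<Sum>k<n. ray_term v k) has_field_derivative 2 * ray_cert ?v n / ?v) (at (of_real s * w))" .
      have 2: "((\<lambda>s::real. of_real s * w) has_vector_derivative w) (at s)"
        by (auto intro!: derivative_eq_intros simp: scaleR_conv_of_real)
      have "(S n has_vector_derivative w * (2 * ray_cert ?v n / ?v)) (at s)"
        using field_vector_diff_chain_at[OF 2 1] by (simp add: S_def o_def)
      then show "(S n has_vector_derivative 2 * ray_cert ?v n / of_real s) (at s)"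
        using w(2) s by simp
      have "(\<phi> has_real_derivative Q * sqrt n / (2 * \<kappa> * (real n - 2)) *
          (exp (- \<kappa> * (1 - s\<^sup>2) * (real n - 2)) * (- \<kappa> * (- 2 * s) * (real n - 2)))) (at s)"
      proof -
        have "((\<lambda>s. exp (- \<kappa> * (1 - s\<^sup>2) * k)) has_real_derivative
            exp (- \<kappa> * (1 - s\<^sup>2) * k) * (- \<kappa> * (- 2 * s) * k)) (at s)" for k
          by (auto intro!: derivative_eq_intros)
        then show ?thesis unfolding \<phi>_def by (rule DERIV_cmult)
      qed
      also have "Q * sqrt n / (2 * \<kappa> * (real n - 2)) *
          (exp (- \<kappa> * (1 - s\<^sup>2) * (real n - 2)) * (- \<kappa> * (- 2 * s) * (real n - 2)))
         = Q * sqrt n * s * exp (- \<kappa> * (1 - s\<^sup>2) * (real n - 2))"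
      proof -
        have alg: "A / (2 * \<kappa> * k) * (e * (- \<kappa> * (- 2 * s) * k)) = A * s * e" if "k \<noteq> 0" for A e k :: real
          using that kap by simp
        have "real n - 2 \<noteq> 0" using n by simp
        then show ?thesis by (rule alg)
      qed
      also have "exp (- \<kappa> * (1 - s\<^sup>2) * (real n - 2)) = exp (- \<kappa> * (1 - s\<^sup>2)) ^ (n - 2)"
        using n by (simp add: exp_of_nat_mult[symmetric] of_nat_diff mult_ac)
      finally show "(\<phi> has_vector_derivative Q * sqrt n * s * exp (- \<kappa> * (1 - s\<^sup>2)) ^ (n - 2)) (at s)"
        by (simp add: has_real_derivative_iff_has_vector_derivative)
      show "norm (2 * ray_cert ?v n / of_real s) \<le> Q * sqrt n * s * exp (- \<kappa> * (1 - s\<^sup>2)) ^ (n - 2)"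
        using s n by (intro cert_le) auto
    qed simp
    moreover have "S n 0 = 0"
      unfolding S_def by (rule sum.neutral) (auto simp: ray_term_def ray_ratio_def power_0_left)
    moreover have "\<phi> 0 \<ge> 0"
      unfolding \<phi>_def using Q0 kap n by (intro mult_nonneg_nonneg divide_nonneg_nonneg) auto
    moreover have "\<phi> 1 = Q * sqrt n / (2 * \<kappa> * (real n - 2))"
      by (simp add: \<phi>_def)
    ultimately show ?thesis by simp
  qed
  have "(\<lambda>n. S n 1) \<longlonglongrightarrow> 0"
  proof (rule Lim_null_comparison)
    show "\<forall>\<^sub>F n in sequentially. norm (S n 1) \<le> Q / (2 * \<kappa>) * (sqrt n / (real n - 2))"
      using eventually_ge_at_top[of 3] by eventually_elim (use S_bound in simp)
    have "(\<lambda>n. sqrt (real n) / (real n - 2)) \<longlonglongrightarrow> 0" by real_asymp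
    then show "(\<lambda>n. Q / (2 * \<kappa>) * (sqrt n / (real n - 2))) \<longlonglongrightarrow> 0"
      by (rule tendsto_mult_right_zero)
  qed
  then show ?thesis by (simp add: S_def sums_def)
qed

theorem theorem2:
  fixes x :: complex
  assumes "x \<noteq> -1"
    and "summable (series_term x)"
  shows "(\<Sum>n. series_term x n) = 0"
proof (cases "x = 0")
  case True
  have "series_term x n = 0" for n
    unfolding True by (cases n) (simp_all add: series_term_def inner_sum_def)
  then show ?thesis by simp
next
  case False
  note bound = summable_root_bound[OF assms(1) _ _ _ assms(2)]
  \<comment> \<open>This point corresponds to w at infinity. With a = 0 and b = 1 the root is
    \<open>\<i>\<close>, and the root bound would give 1 \<le> 9/16.\<close>
  have x14: "1 + 4 * x \<noteq> 0"
  proof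
    assume "1 + 4 * x = 0"
    then have x: "x = -1 / 4" by (simp add: field_simps add_eq_0_iff)
    have "norm (4 * x) * (norm \<i>)\<^sup>2 \<le> norm (1::complex) * (norm (1 + x))\<^sup>2"
      by (rule bound[where a = 0]) (auto simp: x)
    moreover have "1 + x = of_real (3 / 4)" "4 * x = of_real (- 1)" by (simp_all add: x)
    ultimately show False by (simp only: norm_of_real) (simp add: power2_eq_square)
  qed
  \<comment> \<open>Solves x = w^2 / (4 (1 - w^2)) for w^2; the principal root gives Re w \<ge>
    0.\<close>
  define w where "w = csqrt (4 * x / (1 + 4 * x))"
  have w2: "w\<^sup>2 = 4 * x / (1 + 4 * x)" by (simp add: w_def)
  have one_minus: "1 - w\<^sup>2 = 1 / (1 + 4 * x)" using x14 unfolding w2 by (simp add: field_simps)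
  have Re: "Re w \<ge> 0" using csqrt_principal[of "4 * x / (1 + 4 * x)"] unfolding w_def by auto
  have w0: "w \<noteq> 0" using False x14 by (simp add: w_def)
  have x1: "1 + x \<noteq> 0" using assms(1) by (metis add_eq_0_iff)
  have q: "4 - 3 * w\<^sup>2 = 4 * (1 + x) / (1 + 4 * x)" using x14 unfolding w2 by (simp add: field_simps)
  \<comment> \<open>The root bound for a = 1 at the root 1 + w. Multiplied by
    \<open>16 / norm (1 + 4 * x)\<close> it becomes the squared inequality that defines the
    region.\<close>
  have "norm (4 * x) * (norm (1 + w))\<^sup>2 \<le> norm (1 - w\<^sup>2) * (norm (1 + x))\<^sup>2"
  proof (rule bound[where a = 1])
    show "1 - w\<^sup>2 \<noteq> 0" "1\<^sup>2 = (1 + 4 * x) * (1 - w\<^sup>2)" using x14 by (simp_all add: one_minus)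
    show "(1 + w)\<^sup>2 - 2 * 1 * (1 + w) + (1 - w\<^sup>2) = 0" by (simp add: power2_eq_square algebra_simps)
  qed
  have "(norm (4 * w * (1 + w)))\<^sup>2 = 16 * norm (w\<^sup>2) * (norm (1 + w))\<^sup>2"
    by (simp add: norm_mult norm_power power_mult_distrib)
  also have "\<dots> = 16 * (norm (4 * x) * (norm (1 + w))\<^sup>2) / norm (1 + 4 * x)"
    unfolding w2 norm_divide by simp
  also have "\<dots> \<le> 16 * (norm (1 - w\<^sup>2) * (norm (1 + x))\<^sup>2) / norm (1 + 4 * x)"
    using \<open>norm (4 * x) * _ \<le> _\<close> by (intro divide_right_mono mult_left_mono) auto
  also have "\<dots> = (norm (4 - 3 * w\<^sup>2))\<^sup>2"
    unfolding one_minus q norm_divide norm_mult using x14 by (simp add: power2_eq_square)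
  finally have "norm (4 * w * (1 + w)) \<le> norm (4 - 3 * w\<^sup>2)"
    by (rule power2_le_imp_le) simp
  then have "(\<lambda>n. ray_term w n) sums 0"
    by (intro ray_term_sums Re w0)
  then have "(\<lambda>n. (1 + x)\<^sup>2 * ray_term w n) sums ((1 + x)\<^sup>2 * 0)"
    by (rule sums_mult)
  moreover have "series_term x = (\<lambda>n. (1 + x)\<^sup>2 * ray_term w n)"
  proof (rule ext, rule series_term_eq_ray_term)
    show "w\<^sup>2 \<noteq> 1" using one_minus x14 by auto
    show "4 - 3 * w\<^sup>2 \<noteq> 0" unfolding q divide_eq_0_iff mult_eq_0_iff using x1 x14 by simp
    show "x = w\<^sup>2 / (4 * (1 - w\<^sup>2))" by (simp only: one_minus) (use x14 in \<open>simp add: w2\<close>)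
  qed
  ultimately have "series_term x sums 0" by simp
  then show ?thesis by (rule sums_unique[symmetric])
qed

end
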